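(* Let $\tau\in\mathfrak M_{1,c}(\mathcal P)$. Suppose that $J_{\ker}(G_\tau)=\emptyset$ and $\hat K(G_\tau)\ne\emptyset$. Then there exists a unique bounded Borel measurable function $\varphi:\hat{\mathbb C}\to\mathbb R$ such that $\varphi=M_\tau(\varphi)$, $\varphi|_{F_\infty(G_\tau)}\equiv1$ and $\varphi|_{\hat K(G_\tau)}\equiv0$. Moreover, $\varphi=T_{\infty,\tau}$.
   Context: $\hat{\mathbb C}$ is the Riemann sphere with spherical distance $d$. $\mathcal P$ is the set of polynomial maps $\hat{\mathbb C}\to\hat{\mathbb C}$ of degree at least $2$, with the metric $\kappa(f,g)=\sup_zd(f(z),g(z))$. $\mathfrak M_{1,c}(\mathcal P)$ is the set of Borel probability measures on $\mathcal P$ with compact topological support. For a semigroup $G$ of non-constant rational maps, $F(G)$ is the set of $z$ having a neighborhood $U$ on which $\{g|_U\}_{g\in G}$ is equicontinuous with respect to $d$; $J(G)=\hat{\mathbb C}\setminus F(G)$; $J_{\ker}(G)=\bigcap_{g\in G}g^{-1}(J(G))$. For a semigroup $G$ of polynomials, $\hat K(G)=\{z\in\mathbb C:\{g(z):g\in G\}\text{ is bounded in }\mathbb C\}$, and, if $\infty\in F(G)$ (which holds when $G$ is generated by a compact subset of $\mathcal P$), $F_\infty(G)$ is the connected component of $F(G)$ containing $\infty$. $G_\tau$ is the semigroup generated under composition by $\operatorname{supp}\tau$, and $\tilde\tau=\otimes_{j=1}^\infty\tau$. $T_{\infty,\tau}(z)=\tilde\tau(\{\gamma=(\gamma_1,\gamma_2,\dots):\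 \gamma_n\circ\cdots\circ\gamma_1(z)\to\infty\text{ as }n\to\infty\})$, and $M_\tau(\varphi)(z)=\int\varphi(g(z))\,d\tau(g)$ for bounded Borel functions $\varphi$. *)

theory Defs
  imports "HOL-Probability.Probability" "HOL-Computational_Algebra.Polynomial"
begin

section \<open>The Riemann sphere with its spherical distance\<close>

datatype csphere = Fin complex | Infinity

text \<open>
  Inverse stereographic projection onto the unit sphere of \<open>\<complex> \<times> \<real>\<close>. The spherical
  distance is the length of the shortest great-circle arc, i.e. the angle between the two images.
\<close>

fun stereo :: "csphere \<Rightarrow> complex \<times> real" where
  "stereo (Fin z) = ((2 / (1 + (cmod z)\<^sup>2)) *\<^sub>R z, ((cmod z)\<^sup>2 - 1) / ((cmod z)\<^sup>2 + 1))"
| "stereo Infinity = (0, 1)"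

lemma inner_stereo_self: "stereo x \<bullet> stereo x = 1"
proof (cases x)
  case (Fin z)
  define n where "n = (cmod z)\<^sup>2"
  have n: "n \<ge> 0" by (simp add: n_def)
  have "stereo x \<bullet> stereo x = (2 / (1 + n))\<^sup>2 * n + ((n - 1) / (n + 1))\<^sup>2"
    unfolding Fin stereo.simps inner_Pair inner_scaleR_left inner_scaleR_right
    unfolding dot_square_norm n_def by (simp add: power2_eq_square)
  also have "\<dots> = 1"
    using n by (simp add: power_divide divide_simps add_eq_0_iff) (simp add: algebra_simps power2_eq_square)
  finally show ?thesis .
qed simp

lemma norm_stereo [simp]: "norm (stereo x) = 1"
  by (simp add: norm_eq_sqrt_inner inner_stereo_self)

lemma stereo_inj: "stereo x = stereo y \<Longrightarrow> x = y"
proof -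
  have inf: "((cmod z)\<^sup>2 - 1) / ((cmod z)\<^sup>2 + 1) \<noteq> 1" for z
    by (simp add: divide_eq_eq)
  have fin: "z = w" if *: "stereo (Fin z) = stereo (Fin w)" for z w
  proof -
    have pos: "1 + (cmod z)\<^sup>2 \<noteq> 0" "1 + (cmod w)\<^sup>2 \<noteq> 0"
      by (metis add_pos_nonneg less_irrefl zero_le_power2 zero_less_one)+
    from * have "((cmod z)\<^sup>2 - 1) / ((cmod z)\<^sup>2 + 1) = ((cmod w)\<^sup>2 - 1) / ((cmod w)\<^sup>2 + 1)"
      by simp
    then have "((cmod z)\<^sup>2 - 1) * ((cmod w)\<^sup>2 + 1) = ((cmod w)\<^sup>2 - 1) * ((cmod z)\<^sup>2 + 1)"
      using pos by (simp add: frac_eq_eq add.commute)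
    then have "(cmod z)\<^sup>2 = (cmod w)\<^sup>2"
      by (simp add: algebra_simps)
    with * pos show "z = w"
      by simp
  qed
  assume "stereo x = stereo y"
  then show "x = y"
    using inf fin by (cases x; cases y) (auto simp del: stereo.simps(1) simp: prod_eq_iff, auto)
qed

lemma abs_inner_le_1:
  fixes x y :: "'a :: real_inner"
  assumes "norm x = 1" "norm y = 1"
  shows "\<bar>x \<bullet> y\<bar> \<le> 1"
  using Cauchy_Schwarz_ineq2 [of x y] assms by simp

lemma arccos_inner_triangle:
  fixes x y z :: "'a :: real_inner"
  assumes x: "norm x = 1" and y: "norm y = 1" and z: "norm z = 1"
  shows "arccos (x \<bullet> z) \<le> arccos (x \<bullet> y) + arccos (y \<bullet> z)"
proof -
  define a where "a = x \<bullet> y"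
  define b where "b = y \<bullet> z"
  have ab: "\<bar>a\<bar> \<le> 1" "\<bar>b\<bar> \<le> 1" and xz: "\<bar>x \<bullet> z\<bar> \<le> 1"
    unfolding a_def b_def using abs_inner_le_1 x y z by blast+
  have range: "0 \<le> arccos a" "0 \<le> arccos b" "arccos (x \<bullet> z) \<le> pi"
    using ab xz by (auto intro!: arccos_lbound arccos_ubound)
  have xx: "x \<bullet> x = 1" and yy: "y \<bullet> y = 1" and zz: "z \<bullet> z = 1"
    using x y z by (simp_all add: dot_square_norm)
  define u where "u = x - a *\<^sub>R y"
  define v where "v = z - b *\<^sub>R y"
  have "u \<bullet> u = 1 - a\<^sup>2" "v \<bullet> v = 1 - b\<^sup>2"
    unfolding u_def v_def a_def b_def
    by (simp_all add: inner_diff_left inner_diff_right xx yy zz inner_commute power2_eq_square)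
  then have nuv: "norm u = sqrt (1 - a\<^sup>2)" "norm v = sqrt (1 - b\<^sup>2)"
    by (simp_all add: norm_eq_sqrt_inner)
  have uv: "u \<bullet> v = x \<bullet> z - a * b"
    unfolding u_def v_def a_def b_def
    by (simp add: inner_diff_left inner_diff_right xx yy zz inner_commute)
  have "cos (arccos a + arccos b) = a * b - sqrt (1 - a\<^sup>2) * sqrt (1 - b\<^sup>2)"
    using ab by (simp add: cos_add sin_arccos_abs cos_arccos_abs)
  also have "\<dots> \<le> x \<bullet> z"
    using Cauchy_Schwarz_ineq2 [of u v] unfolding uv nuv by linarith
  also have "\<dots> = cos (arccos (x \<bullet> z))"
    using xz by (simp add: cos_arccos_abs)
  finally have le: "cos (arccos a + arccos b) \<le> cos (arccos (x \<bullet> z))" .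
  show ?thesis
  proof (cases "arccos a + arccos b \<le> pi")
    case True
    then have "arccos (x \<bullet> z) \<le> arccos a + arccos b"
      using le range xz by (subst (asm) cos_mono_le_eq) (auto intro!: arccos_lbound)
    then show ?thesis by (simp add: a_def b_def)
  next
    case False
    then show ?thesis using range by (simp add: a_def b_def)
  qed
qed

instantiation csphere :: metric_space
begin

definition dist_csphere :: "csphere \<Rightarrow> csphere \<Rightarrow> real" where
  "dist_csphere x y = arccos (stereo x \<bullet> stereo y)"

definition uniformity_csphere :: "(csphere \<times> csphere) filter" where
  "uniformity_csphere = (INF e\<in>{0 <..}. principal {(x, y). dist x y < e})"

definition open_csphere :: "csphere set \<Rightarrow> bool" where
  "open_csphere U = (\<forall>x\<in>U. eventually (\<lambda>(x', y). x' = x \<longrightarrow> y \<in> U) uniformity)"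

instance
proof
  fix x y z :: csphere
  show "dist x y = 0 \<longleftrightarrow> x = y"
  proof
    assume "dist x y = 0"
    then have "stereo x \<bullet> stereo y = cos 0"
      using abs_inner_le_1 [of "stereo x" "stereo y"]
      by (metis cos_arccos_abs dist_csphere_def norm_stereo)
    then have "(norm (stereo x - stereo y))\<^sup>2 = 0"
      by (simp add: power2_norm_eq_inner inner_diff_left inner_diff_right inner_stereo_self
          inner_commute)
    then show "x = y"
      by (auto intro: stereo_inj)
  qed (simp add: dist_csphere_def inner_stereo_self)
  show "dist x y \<le> dist x z + dist y z"
    using arccos_inner_triangle [of "stereo x" "stereo z" "stereo y"]
    by (simp add: dist_csphere_def inner_commute)
qed (simp_all add: uniformity_csphere_def open_csphere_def)

end

lemma dist_csphere_le_pi: "dist x y \<le> pi" for x y :: csphere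
  using abs_inner_le_1 [of "stereo x" "stereo y"]
  by (auto simp: dist_csphere_def intro!: arccos_ubound)


section \<open>The space of polynomial maps of degree at least two\<close>

text \<open>The value at \<open>Infinity\<close> is the continuous extension only if \<open>p\<close> is not constant.\<close>

fun sphere_poly :: "complex poly \<Rightarrow> csphere \<Rightarrow> csphere" where
  "sphere_poly p (Fin z) = Fin (poly p z)"
| "sphere_poly p Infinity = Infinity"

typedef poly_map = "{f. \<exists>p. degree p \<ge> 2 \<and> f = sphere_poly p}"
  morphisms pm_apply Abs_poly_map
proof -
  have "degree (monom 1 2 :: complex poly) \<ge> 2" by (simp add: degree_monom_eq)
  then show ?thesis by blast
qed

instantiation poly_map :: metric_space
begin

definition dist_poly_map :: "poly_map \<Rightarrow> poly_map \<Rightarrow> real" where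
  "dist_poly_map f g = (SUP z. dist (pm_apply f z) (pm_apply g z))"

definition uniformity_poly_map :: "(poly_map \<times> poly_map) filter" where
  "uniformity_poly_map = (INF e\<in>{0 <..}. principal {(f, g). dist f g < e})"

definition open_poly_map :: "poly_map set \<Rightarrow> bool" where
  "open_poly_map U = (\<forall>f\<in>U. eventually (\<lambda>(f', g). f' = f \<longrightarrow> g \<in> U) uniformity)"

instance
proof
  fix f g h :: poly_map
  have le: "dist (pm_apply f z) (pm_apply g z) \<le> dist f g" for f g z
    unfolding dist_poly_map_def
    by (rule cSUP_upper) (auto intro!: bdd_aboveI2 dist_csphere_le_pi)
  show "dist f g = 0 \<longleftrightarrow> f = g"
  proof
    assume "dist f g = 0"
    then have "pm_apply f z = pm_apply g z" for z
      using le [of f z g] by simp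
    then show "f = g"
      by (simp add: ext flip: pm_apply_inject)
  qed (simp add: dist_poly_map_def)
  show "dist f g \<le> dist f h + dist g h"
    unfolding dist_poly_map_def [of f g]
  proof (rule cSUP_least)
    fix z
    show "dist (pm_apply f z) (pm_apply g z) \<le> dist f h + dist g h"
      using dist_triangle2 [of "pm_apply f z" "pm_apply g z" "pm_apply h z"] le [of f z h] le [of g z h]
      by linarith
  qed simp
qed (simp_all add: uniformity_poly_map_def open_poly_map_def)

end


section \<open>Semigroups of self-maps: Fatou, Julia, kernel Julia and filled-in sets\<close>

inductive_set generated_semigroup :: "('a \<Rightarrow> 'a) set \<Rightarrow> ('a \<Rightarrow> 'a) set"
  for S :: "('a \<Rightarrow> 'a) set" where
  gen: "f \<in> S \<Longrightarrow> f \<in> generated_semigroup S"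
| comp: "f \<in> generated_semigroup S \<Longrightarrow> g \<in> generated_semigroup S \<Longrightarrow>
    f \<circ> g \<in> generated_semigroup S"

definition equicontinuous_on :: "'a set \<Rightarrow> ('a::metric_space \<Rightarrow> 'b::metric_space) set \<Rightarrow> bool" where
  "equicontinuous_on U G \<longleftrightarrow>
    (\<forall>x\<in>U. \<forall>e>0. \<exists>\<delta>>0. \<forall>g\<in>G. \<forall>y\<in>U. dist y x < \<delta> \<longrightarrow> dist (g y) (g x) < e)"

definition Fatou :: "(csphere \<Rightarrow> csphere) set \<Rightarrow> csphere set" where
  "Fatou G = {z. \<exists>U. open U \<and> z \<in> U \<and> equicontinuous_on U G}"

definition Julia :: "(csphere \<Rightarrow> csphere) set \<Rightarrow> csphere set" where
  "Julia G = - Fatou G"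

definition Julia_ker :: "(csphere \<Rightarrow> csphere) set \<Rightarrow> csphere set" where
  "Julia_ker G = (\<Inter>g\<in>G. g -` Julia G)"

definition K_hat :: "(csphere \<Rightarrow> csphere) set \<Rightarrow> complex set" where
  "K_hat G = {z. \<exists>B. bounded B \<and> (\<lambda>g. g (Fin z)) ` G \<subseteq> Fin ` B}"

definition Fatou_inf :: "(csphere \<Rightarrow> csphere) set \<Rightarrow> csphere set" where
  "Fatou_inf G = connected_component_set (Fatou G) Infinity"


section \<open>Random dynamics of polynomial maps\<close>

definition msupport :: "'a::topological_space measure \<Rightarrow> 'a set" where
  "msupport \<tau> = {x. \<forall>U. open U \<and> x \<in> U \<longrightarrow> emeasure \<tau> U > 0}"

definition M1c :: "poly_map measure set" where
  "M1c = {\<tau>. sets \<tau> = sets borel \<and> prob_space \<tau> \<and> compact (msupport \<tau>)}"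

definition G_semigroup :: "poly_map measure \<Rightarrow> (csphere \<Rightarrow> csphere) set" where
  "G_semigroup \<tau> = generated_semigroup (pm_apply ` msupport \<tau>)"

text \<open>
  Sequences are indexed from \<open>0\<close>: the map \<open>\<gamma> 0\<close> is applied first, so
  \<open>random_orbit \<gamma> z n = \<gamma> (n - 1) (\<dots> (\<gamma> 0 z))\<close>.
\<close>

primrec random_orbit :: "(nat \<Rightarrow> poly_map) \<Rightarrow> csphere \<Rightarrow> nat \<Rightarrow> csphere" where
  "random_orbit \<gamma> z 0 = z"
| "random_orbit \<gamma> z (Suc n) = pm_apply (\<gamma> n) (random_orbit \<gamma> z n)"

definition T_inf :: "poly_map measure \<Rightarrow> csphere \<Rightarrow> real" where
  "T_inf \<tau> z = measure (\<Pi>\<^sub>M j\<in>UNIV. \<tau>)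
     {\<gamma> \<in> space (\<Pi>\<^sub>M j\<in>(UNIV :: nat set). \<tau>). random_orbit \<gamma> z \<longlonglongrightarrow> Infinity}"

definition M_op :: "poly_map measure \<Rightarrow> (csphere \<Rightarrow> real) \<Rightarrow> csphere \<Rightarrow> real" where
  "M_op \<tau> \<phi> z = (\<integral>g. \<phi> (pm_apply g z) \<partial>\<tau>)"

definition is_solution :: "poly_map measure \<Rightarrow> (csphere \<Rightarrow> real) \<Rightarrow> bool" where
  "is_solution \<tau> \<phi> \<longleftrightarrow>
     \<phi> \<in> borel_measurable borel \<and> bounded (range \<phi>) \<and>
     \<phi> = M_op \<tau> \<phi> \<and>
     (\<forall>z\<in>Fatou_inf (G_semigroup \<tau>). \<phi> z = 1) \<and>
     (\<forall>z\<in>K_hat (G_semigroup \<tau>). \<phi> (Fin z) = 0)"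

end

theory Submission
  imports Defs "HOL-Computational_Algebra.Fundamental_Theorem_Algebra"
begin

text \<open>
  Compactness of the support yields one disc outside which every map of the support at least doubles
  the modulus. Its complement \<open>V\<close> lies in the component of the Fatou set at infinity, and
  every orbit that meets \<open>V\<close> tends to infinity. Since the kernel Julia set is empty, every
  point is mapped by some element of the semigroup into \<open>V\<close> or into the interior of
  \<open>K_hat\<close>: a point outside \<open>K_hat\<close> has an unbounded orbit, and a point of
  \<open>K_hat\<close> can be moved into the Fatou set, whose intersection with \<open>K_hat\<close> is
  open. The difference \<open>\<psi>\<close> of two solutions vanishes on these two open sets; the set of
  points near which \<open>\<bar>\<psi>\<bar>\<close> comes arbitrarily close to its supremum is nonempty and
  forward invariant, so the supremum is \<open>0\<close>.
\<close>

section \<open>The topology of the sphere\<close>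

text \<open>Two unit vectors at angle \<open>t\<close> are joined by a chord of length
  \<open>2 * sin (t / 2)\<close>, which is at most \<open>t\<close>. Hence \<open>stereo\<close> is
  1-Lipschitz for the spherical distance.\<close>

lemma chord_le_dist: "norm (stereo x - stereo y) \<le> dist x y"
proof -
  define t where "t = dist x y"
  have t: "0 \<le> t" "t \<le> pi" by (simp_all add: t_def dist_csphere_le_pi)
  have "cos t = stereo x \<bullet> stereo y"
    using abs_inner_le_1 [of "stereo x" "stereo y"] by (simp add: t_def dist_csphere_def cos_arccos_abs)
  then have "(norm (stereo x - stereo y))\<^sup>2 = 2 - 2 * cos t"
    by (simp add: power2_norm_eq_inner inner_diff_left inner_diff_right inner_stereo_self inner_commute)
  also have "cos t = 1 - 2 * (sin (t / 2))\<^sup>2"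
    using cos_double_sin [of "t / 2"] by simp
  also have "2 - 2 * (1 - 2 * (sin (t / 2))\<^sup>2) = (2 * sin (t / 2))\<^sup>2"
    by (simp add: power2_eq_square)
  also have "\<dots> \<le> t\<^sup>2"
    using sin_x_le_x [of "t / 2"] sin_ge_zero [of "t / 2"] t by (intro power_mono) auto
  finally show ?thesis
    using t by (simp add: t_def)
qed

lemma continuous_on_stereo: "continuous_on A stereo"
proof (unfold continuous_on_iff, intro ballI allI impI exI conjI)
  show "dist (stereo y) (stereo x) < e" if "dist y x < e" for x y e
    using that chord_le_dist [of y x] by (simp only: dist_norm)
qed

text \<open>The converse holds because \<open>dist\<close> is \<open>arccos\<close> of an inner
  product and \<open>arccos\<close> is continuous on [-1, 1]. Thus \<open>stereo\<close> is a
  homeomorphism onto its image, and limits on the sphere can be computed in coordinates.\<close>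

lemma tendsto_csphere_iff:
  fixes f :: "'a \<Rightarrow> csphere"
  shows "(f \<longlongrightarrow> l) F \<longleftrightarrow> ((\<lambda>x. stereo (f x)) \<longlongrightarrow> stereo l) F"
proof
  assume "(f \<longlongrightarrow> l) F"
  then show "((\<lambda>x. stereo (f x)) \<longlongrightarrow> stereo l) F"
    by (rule continuous_on_tendsto_compose [OF continuous_on_stereo [of UNIV]]) simp_all
next
  assume *: "((\<lambda>x. stereo (f x)) \<longlongrightarrow> stereo l) F"
  have "((\<lambda>x. stereo (f x) \<bullet> stereo l) \<longlongrightarrow> stereo l \<bullet> stereo l) F"
    by (intro tendsto_intros *)
  moreover have "continuous_on {-1..1} arccos"
    by (rule continuous_on_arccos')
  moreover have "stereo x \<bullet> stereo y \<in> {-1..1}" for x y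
    using abs_inner_le_1 [of "stereo x" "stereo y"] by auto
  ultimately have "((\<lambda>x. arccos (stereo (f x) \<bullet> stereo l)) \<longlongrightarrow> arccos (stereo l \<bullet> stereo l)) F"
    by (intro continuous_on_tendsto_compose [of _ arccos] always_eventually allI)
  then show "(f \<longlongrightarrow> l) F"
    by (subst tendsto_dist_iff) (simp add: dist_csphere_def inner_stereo_self)
qed

lemma continuous_on_Fin [continuous_intros]:
  assumes "continuous_on A f"
  shows "continuous_on A (\<lambda>x. Fin (f x))"
proof -
  have [simp]: "1 + (cmod z)\<^sup>2 \<noteq> 0" "(cmod z)\<^sup>2 + 1 \<noteq> 0" for z
    by (metis add_pos_nonneg add.commute less_irrefl zero_le_power2 zero_less_one)+
  have "continuous_on A (\<lambda>x. stereo (Fin (f x)))"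
    unfolding stereo.simps by (intro continuous_intros assms) simp_all
  then show ?thesis
    by (simp add: continuous_on_def tendsto_csphere_iff)
qed

text \<open>Stereographic projection from the north pole, written through \<open>stereo\<close> so
  that its continuity off \<open>Infinity\<close> is immediate. At \<open>Infinity\<close> division
  by zero makes it 0.\<close>

definition unfin :: "csphere \<Rightarrow> complex" where
  "unfin x = (1 / (1 - snd (stereo x))) *\<^sub>R fst (stereo x)"

lemma snd_stereo_Fin_neq: "snd (stereo (Fin z)) \<noteq> 1"
  unfolding stereo.simps snd_conv by (simp add: divide_eq_eq)

lemma unfin_Fin [simp]: "unfin (Fin z) = z"
proof -
  have "1 / (1 - (n - 1) / (n + 1)) * (2 / (1 + n)) = 1" if "0 \<le> n" for n :: real
  proof -
    have "1 - (n - 1) / (n + 1) = 2 / (1 + n)"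
      using that by (simp add: divide_simps)
    then have "1 / (1 - (n - 1) / (n + 1)) * (2 / (1 + n)) = 1 / (2 / (1 + n)) * (2 / (1 + n))"
      by (simp only:)
    also have "\<dots> = 1" using that by simp
    finally show ?thesis .
  qed
  then show ?thesis
    by (simp only: unfin_def stereo.simps fst_conv snd_conv scaleR_scaleR zero_le_power2 scaleR_one)
qed

lemma continuous_on_unfin: "continuous_on (- {Infinity}) unfin"
proof -
  have "snd (stereo x) \<noteq> 1" if "x \<in> - {Infinity}" for x
    using that snd_stereo_Fin_neq by (cases x) auto
  then show ?thesis
    unfolding unfin_def by (intro continuous_intros continuous_on_stereo) auto
qed

lemma range_stereo: "range stereo = sphere 0 1"
proof (rule subset_antisym)
  show "sphere 0 1 \<subseteq> range stereo"
  proof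
    fix s :: "complex \<times> real" assume s: "s \<in> sphere 0 1"
    obtain w t where [simp]: "s = (w, t)" by (cases s)
    have wt: "(cmod w)\<^sup>2 + t\<^sup>2 = 1"
      using s by (simp add: norm_Pair)
    show "s \<in> range stereo"
    proof (cases "t = 1")
      case True
      with wt have "s = stereo Infinity" by simp
      then show ?thesis by blast
    next
      case False
      have "t\<^sup>2 \<le> 1" using wt by (metis le_add_same_cancel2 zero_le_power2)
      then have "t < 1" using False by (simp add: power2_le_iff_abs_le abs_le_iff abs_square_le_1)
      \<comment> \<open>The line from the north pole through \<open>s\<close> meets the equatorial
        plane at \<open>z\<close>.\<close>
      define z where "z = (1 / (1 - t)) *\<^sub>R w"
      have "(cmod z)\<^sup>2 = (1 - t\<^sup>2) / (1 - t)\<^sup>2"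
        using wt by (simp add: z_def power_divide divide_simps)
      also have "\<dots> = (1 + t) / (1 - t)"
        using \<open>t < 1\<close> square_diff_square_factored [of 1 t] by (simp add: power2_eq_square)
      finally have z: "(cmod z)\<^sup>2 = (1 + t) / (1 - t)" .
      have "1 + (cmod z)\<^sup>2 = 2 / (1 - t)" "(cmod z)\<^sup>2 - 1 = 2 * t / (1 - t)"
        unfolding z using \<open>t < 1\<close> by (simp_all add: field_simps)
      then have "stereo (Fin z) = s"
        using \<open>t < 1\<close> by (simp add: add.commute[of _ 1] z_def)
      then show ?thesis by blast
    qed
  qed
qed auto

text \<open>The sphere is the image of the compact unit sphere under the inverse of
  \<open>stereo\<close>; by \<open>tendsto_csphere_iff\<close> continuity of this inverse reduces to
  continuity of the identity.\<close>

lemma compact_UNIV_csphere: "compact (UNIV :: csphere set)"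
proof -
  have inv: "inv stereo (stereo x) = x" for x
    by (metis inv_f_f injI stereo_inj)
  have "continuous_on (sphere 0 1) (inv stereo)"
    unfolding continuous_on_def range_stereo [symmetric]
    by (auto simp: tendsto_csphere_iff inv f_inv_into_f eventually_at_filter
        intro!: Lim_transform_within [OF tendsto_ident_at zero_less_one])
  then have "compact (inv stereo ` sphere 0 1)"
    by (intro compact_continuous_image compact_sphere)
  moreover have "inv stereo ` sphere 0 1 = UNIV"
    unfolding range_stereo [symmetric] using inv by (metis surj_def image_comp comp_apply)
  ultimately show ?thesis by simp
qed

section \<open>Spherical distance to infinity in terms of the modulus\<close>

lemma dist_Fin_Infinity: "dist (Fin z) Infinity = arccos (1 - 2 / ((cmod z)\<^sup>2 + 1))"
proof -
  have "(n - 1) / (n + 1) = 1 - 2 / (n + 1)" if "0 \<le> n" for n :: real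
    using that by (simp add: field_simps)
  then have "((cmod z)\<^sup>2 - 1) / ((cmod z)\<^sup>2 + 1) = 1 - 2 / ((cmod z)\<^sup>2 + 1)"
    by simp
  then show ?thesis by (simp add: dist_csphere_def)
qed

text \<open>\<open>arccos\<close> is decreasing while its argument increases with the modulus. This
  turns balls about \<open>Infinity\<close> into complements of discs and back.\<close>

lemma dist_Fin_Infinity_le_iff:
  "dist (Fin z) Infinity \<le> dist (Fin w) Infinity \<longleftrightarrow> cmod w \<le> cmod z"
proof -
  have bound: "\<bar>1 - 2 / (n + 1)\<bar> \<le> 1" if "0 \<le> n" for n :: real
    using that by (simp add: abs_le_iff field_simps)
  have mono: "1 - 2 / (m + 1) \<le> 1 - 2 / (n + 1) \<longleftrightarrow> m \<le> n" if "0 \<le> m" "0 \<le> n" for m n :: real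
    using that by (simp add: field_simps)
  show ?thesis
    unfolding dist_Fin_Infinity by (simp add: arccos_le_mono bound mono del: diff_le_eq diff_right_mono)
qed

lemma dist_Fin_Infinity_less_iff:
  "dist (Fin z) Infinity < dist (Fin w) Infinity \<longleftrightarrow> cmod w < cmod z"
  using dist_Fin_Infinity_le_iff [of z w] dist_Fin_Infinity_le_iff [of w z] by linarith

lemma Fin_tendsto_Infinity: "(Fin \<longlongrightarrow> Infinity) at_infinity"
proof -
  have "filterlim (\<lambda>z::complex. (cmod z)\<^sup>2 + 1) at_top at_infinity"
    using filterlim_tendsto_add_at_top [OF tendsto_const filterlim_pow_at_top [OF _ filterlim_norm_at_top], of 2 1]
    by (simp add: add.commute)
  then have lim: "((\<lambda>z::complex. 1 - 2 / ((cmod z)\<^sup>2 + 1)) \<longlongrightarrow> 1 - 0) at_infinity"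
    by (rule tendsto_diff [OF tendsto_const real_tendsto_divide_at_top [OF tendsto_const]])
  have bound: "1 - 2 / (n + 1) \<in> {-1..1}" if "0 \<le> n" for n :: real
    using that by (simp add: divide_simps)
  have "((\<lambda>z. arccos (1 - 2 / ((cmod z)\<^sup>2 + 1))) \<longlongrightarrow> arccos (1 - 0)) at_infinity"
  proof (rule continuous_on_tendsto_compose [OF continuous_on_arccos' lim])
    show "\<forall>\<^sub>F z in at_infinity. 1 - 2 / ((cmod z)\<^sup>2 + 1) \<in> {-1..1}"
      by (intro always_eventually allI bound zero_le_power2)
  qed simp
  then show ?thesis
    by (simp only: tendsto_dist_iff [of Fin] dist_Fin_Infinity diff_zero arccos_1)
qed

lemma tendsto_Infinity_iff:
  "((\<lambda>x. Fin (f x)) \<longlongrightarrow> Infinity) F \<longleftrightarrow> filterlim f at_infinity F"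
proof
  assume L: "((\<lambda>x. Fin (f x)) \<longlongrightarrow> Infinity) F"
  show "filterlim f at_infinity F"
    unfolding filterlim_at_infinity [OF order.refl]
  proof (intro allI impI)
    fix r :: real assume "r > 0"
    from L have "\<forall>\<^sub>F x in F. dist (Fin (f x)) Infinity < dist (Fin (complex_of_real r)) Infinity"
      by (rule tendstoD) (simp only: zero_less_dist_iff csphere.distinct not_False_eq_True)
    then have "\<forall>\<^sub>F x in F. r < cmod (f x)"
      using \<open>r > 0\<close> by (simp only: dist_Fin_Infinity_less_iff norm_of_real abs_of_pos)
    then show "\<forall>\<^sub>F x in F. r \<le> cmod (f x)"
      by (rule eventually_mono) simp
  qed
next
  assume "filterlim f at_infinity F"
  then show "((\<lambda>x. Fin (f x)) \<longlongrightarrow> Infinity) F"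
    using filterlim_compose [OF Fin_tendsto_Infinity, of f F] by blast
qed

section \<open>The space of polynomial maps\<close>

lemma countable_subbasis_if_countable_dense:
  fixes D :: "'a::metric_space set"
  assumes "countable D" and dense: "\<And>x e. e > 0 \<Longrightarrow> \<exists>d\<in>D. dist d x < e"
  shows "\<exists>B :: 'a set set. countable B \<and> open = generate_topology B"
proof (intro exI conjI)
  define B where "B = (\<lambda>(d, n). ball d (1 / real (Suc n))) ` (D \<times> UNIV)"
  show "countable B"
    unfolding B_def using \<open>countable D\<close> by (intro countable_image countable_SIGMA) auto
  have "topological_basis B"
  proof (rule topological_basisI)
    show "open b" if "b \<in> B" for b using that by (auto simp: B_def)
  next
    fix U :: "'a set" and x assume "open U" "x \<in> U"
    then obtain e where e: "e > 0" "ball x e \<subseteq> U" by (rule openE)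
    then obtain n where n: "1 / real (Suc n) < e / 2"
      using nat_approx_posE [of "e / 2"] by (metis half_gt_zero)
    obtain d where d: "d \<in> D" "dist d x < 1 / real (Suc n)"
      using dense [of "1 / real (Suc n)" x] by auto
    have "ball d (1 / real (Suc n)) \<subseteq> ball x e"
    proof
      fix y assume "y \<in> ball d (1 / real (Suc n))"
      with d n show "y \<in> ball x e"
        using dist_triangle [of x y d] by (simp add: dist_commute)
    qed
    with d e show "\<exists>b\<in>B. x \<in> b \<and> b \<subseteq> U"
      unfolding B_def by (intro bexI [of _ "ball d (1 / real (Suc n))"]) auto
  qed
  then show "open = generate_topology B"
    by (rule topological_basis_imp_subbasis)
qed

text \<open>One point from each set of the covers of mesh \<open>1 / (n + 1)\<close> gives a
  countable dense set. This form suits \<open>poly_map\<close>, where small sets are easier to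
  describe than a dense sequence.\<close>

lemma countable_subbasis_if_countable_covers:
  assumes cover: "\<And>e. e > 0 \<Longrightarrow> \<exists>C :: 'a::metric_space set set. countable C \<and> \<Union>C = UNIV \<and>
      (\<forall>S\<in>C. \<forall>x\<in>S. \<forall>y\<in>S. dist x y < e)"
  shows "\<exists>B :: 'a set set. countable B \<and> open = generate_topology B"
proof -
  have "\<exists>C :: 'a set set. countable C \<and> \<Union>C = UNIV \<and> (\<forall>S\<in>C. \<forall>x\<in>S. \<forall>y\<in>S. dist x y < 1 / real (Suc n))" for n
    by (rule cover) simp
  then obtain C :: "nat \<Rightarrow> 'a set set" where C: "\<And>n. countable (C n)" "\<And>n. \<Union>(C n) = UNIV"
      "\<And>n S x y. S \<in> C n \<Longrightarrow> x \<in> S \<Longrightarrow> y \<in> S \<Longrightarrow> dist x y < 1 / real (Suc n)"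
    by metis
  show ?thesis
  proof (rule countable_subbasis_if_countable_dense)
    \<comment> \<open>If a cover contains the empty set, \<open>SOME\<close> contributes one
      arbitrary point, which does no harm.\<close>
    show "countable ((\<lambda>S. SOME x. x \<in> S) ` (\<Union>n. C n))"
      using C(1) by auto
    fix x :: 'a and e :: real assume "e > 0"
    then obtain n where n: "1 / real (Suc n) < e"
      using nat_approx_posE by blast
    obtain S where S: "S \<in> C n" "x \<in> S"
      using C(2) [of n] by blast
    then have "dist (SOME x. x \<in> S) x < e"
      using C(3) [OF S(1) someI [of "\<lambda>x. x \<in> S"] S(2), of x] n by simp
    with S show "\<exists>d\<in>(\<lambda>S. SOME x. x \<in> S) ` (\<Union>n. C n). dist d x < e"
      by blast
  qed
qed

lemma csphere_finite_net:
  assumes "e > 0"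
  obtains k :: "csphere set" where "finite k" "\<And>x. \<exists>y\<in>k. dist y x < e"
proof -
  obtain k :: "csphere set" where "finite k" "UNIV \<subseteq> (\<Union>x\<in>k. ball x e)"
    by (rule compactE_image [OF compact_UNIV_csphere, of UNIV "\<lambda>x. ball x e"])
      (use assms centre_in_ball in \<open>blast+\<close>)
  then have "\<exists>y\<in>k. dist y x < e" for x
    using UNIV_I [of x] mem_ball by blast
  with \<open>finite k\<close> show thesis by (rule that)
qed

lemma csphere_finite_nets:
  obtains k :: "nat \<Rightarrow> csphere set"
  where "\<And>n. finite (k n)" "\<And>n x. \<exists>y\<in>k n. dist y x < 1 / real (Suc n)"
proof -
  have "\<exists>k :: csphere set. finite k \<and> (\<forall>x. \<exists>y\<in>k. dist y x < 1 / real (Suc n))" for n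
    by (rule csphere_finite_net [of "1 / real (Suc n)"]) auto
  then show thesis using that by metis
qed

text \<open>The union of the finite nets is dense. Second countability lets
  \<open>borel_prod\<close> identify the Borel sets of a product with the product sigma-algebra, as
  joint measurability of evaluation requires.\<close>

instance csphere :: second_countable_topology
proof
  obtain k :: "nat \<Rightarrow> csphere set" where k: "\<And>n. finite (k n)" "\<And>n x. \<exists>y\<in>k n. dist y x < 1 / real (Suc n)"
    using csphere_finite_nets by blast
  show "\<exists>B :: csphere set set. countable B \<and> open = generate_topology B"
  proof (rule countable_subbasis_if_countable_dense)
    show "countable (\<Union>n. k n)"
      using k(1) by (auto intro: countable_finite)
    fix x :: csphere and e :: real assume "e > 0"
    then obtain n where "1 / real (Suc n) < e"
      using nat_approx_posE by blast
    with k(2) [of n x] show "\<exists>d\<in>(\<Union>n. k n). dist d x < e"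
      by (meson UN_I UNIV_I less_trans)
  qed
qed

section \<open>Continuity of polynomial maps and their metric\<close>

lemma continuous_on_sphere_poly:
  assumes "degree p \<noteq> 0"
  shows "continuous_on UNIV (sphere_poly p)"
proof -
  have "isCont (sphere_poly p) x" for x
  proof (cases x)
    case (Fin z)
    have "continuous_on (- {Infinity}) (\<lambda>y. Fin (poly p (unfin y)))"
      by (intro continuous_intros continuous_on_unfin)
    moreover have "Fin (poly p (unfin y)) = sphere_poly p y" if "y \<in> - {Infinity}" for y
      using that by (cases y) auto
    ultimately have "continuous_on (- {Infinity}) (sphere_poly p)"
      by (rule continuous_on_eq)
    then show ?thesis
      using Fin by (subst (asm) continuous_on_eq_continuous_at) auto
  next
    case Infinity
    have "\<exists>d>0. \<forall>y. dist y Infinity < d \<longrightarrow> dist (sphere_poly p y) Infinity < e" if "e > 0" for e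
    proof -
      have "((\<lambda>z. Fin (poly p z)) \<longlongrightarrow> Infinity) at_infinity"
        using assms by (simp add: tendsto_Infinity_iff filterlim_poly_at_infinity)
      then have "\<forall>\<^sub>F z in at_infinity. dist (Fin (poly p z)) Infinity < e"
        using \<open>e > 0\<close> by (rule tendstoD)
      then obtain b where b: "\<And>z. b \<le> cmod z \<Longrightarrow> dist (Fin (poly p z)) Infinity < e"
        unfolding eventually_at_infinity by blast
      show ?thesis
      \<comment> \<open>A point nearer to \<open>Infinity\<close> than \<open>Fin b\<close> has
        modulus above the absolute value of \<open>b\<close>, hence above \<open>b\<close>, whatever
        the sign of \<open>b\<close>.\<close>
      proof (intro exI [of _ "dist (Fin (complex_of_real b)) Infinity"] conjI allI impI)
        fix y assume "dist y Infinity < dist (Fin (complex_of_real b)) Infinity"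
        with b show "dist (sphere_poly p y) Infinity < e"
          using \<open>e > 0\<close> by (cases y) (auto simp: dist_Fin_Infinity_less_iff)
      qed (simp add: zero_less_dist_iff)
    qed
    then show ?thesis
      using Infinity by (simp add: continuous_at_eps_delta dist_commute)
  qed
  then show ?thesis by (simp add: continuous_at_imp_continuous_on)
qed

lemma pm_apply_cases:
  obtains p where "degree p \<ge> 2" "pm_apply g = sphere_poly p"
  using pm_apply [of g] by blast

lemma pm_apply_Infinity [simp]: "pm_apply g Infinity = Infinity"
  by (rule pm_apply_cases [of g]) simp

lemma continuous_on_pm_apply: "continuous_on UNIV (pm_apply g)"
  by (rule pm_apply_cases [of g]) (simp add: continuous_on_sphere_poly)

lemma uniformly_continuous_on_pm_apply: "uniformly_continuous_on UNIV (pm_apply g)"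
  by (rule compact_uniformly_continuous [OF continuous_on_pm_apply compact_UNIV_csphere])

lemma dist_pm_apply_le: "dist (pm_apply f z) (pm_apply g z) \<le> dist f g"
  unfolding dist_poly_map_def
  by (rule cSUP_upper) (auto intro!: bdd_aboveI2 dist_csphere_le_pi)

lemma dist_poly_map_le:
  assumes "\<And>z. dist (pm_apply f z) (pm_apply g z) \<le> e"
  shows "dist f g \<le> e"
  unfolding dist_poly_map_def by (rule cSUP_least) (use assms in auto)

text \<open>The maps with a given modulus of continuity and given approximate values on a finite net
  form a set of small diameter, and countably many such sets cover the space.\<close>

instance poly_map :: second_countable_topology
proof
  have "\<exists>C :: poly_map set set. countable C \<and> \<Union>C = UNIV \<and> (\<forall>S\<in>C. \<forall>f\<in>S. \<forall>g\<in>S. dist f g < e)"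
    if "e > 0" for e :: real
  proof -
    \<comment> \<open>Two maps in the same \<open>W n v\<close> are compared along f x, f y, v y, g
      y, g x with \<open>y\<close> in the net. The four steps cost at most
      \<open>4 * \<eta>\<close>, which is strictly below \<open>e\<close>.\<close>
    define \<eta> where "\<eta> = e / 5"
    have \<eta>: "\<eta> > 0" using that by (simp add: \<eta>_def)
    obtain D :: "csphere set" where D: "finite D" "\<And>x. \<exists>y\<in>D. dist y x < \<eta>"
      using csphere_finite_net [OF \<eta>] by blast
    obtain k :: "nat \<Rightarrow> csphere set" where k: "\<And>n. finite (k n)" "\<And>n x. \<exists>y\<in>k n. dist y x < 1 / real (Suc n)"
      using csphere_finite_nets by blast
    define W where "W n v = {f. (\<forall>x y. dist y x < 1 / real (Suc n) \<longrightarrow> dist (pm_apply f y) (pm_apply f x) < \<eta>) \<and>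
        (\<forall>x\<in>k n. dist (v x) (pm_apply f x) < \<eta>)}" for n and v :: "csphere \<Rightarrow> csphere"
    \<comment> \<open>For each \<open>n\<close> only finitely many \<open>v\<close> from the net
      \<open>k n\<close> into the net \<open>D\<close> occur, so \<open>C\<close> is
      countable.\<close>
    define C where "C = (\<Union>n. W n ` (k n \<rightarrow>\<^sub>E D))"
    have "countable (W n ` (k n \<rightarrow>\<^sub>E D))" for n
      by (intro countable_image countable_finite finite_PiE k(1) D(1))
    then have "countable C"
      unfolding C_def by simp
    moreover have "f \<in> \<Union>C" for f
    proof -
      obtain d where d: "d > 0" "\<And>x y. dist y x < d \<Longrightarrow> dist (pm_apply f y) (pm_apply f x) < \<eta>"
        using uniformly_continuous_on_pm_apply [of f] \<eta> unfolding uniformly_continuous_on_def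
        by (metis UNIV_I)
      obtain n where n: "1 / real (Suc n) < d"
        using nat_approx_posE [OF d(1)] by blast
      define v where "v = restrict (\<lambda>x. SOME y. y \<in> D \<and> dist y (pm_apply f x) < \<eta>) (k n)"
      have v: "v x \<in> D \<and> dist (v x) (pm_apply f x) < \<eta>" if "x \<in> k n" for x
        using that D(2) [of "pm_apply f x"] someI_ex [of "\<lambda>y. y \<in> D \<and> dist y (pm_apply f x) < \<eta>"]
        unfolding v_def by auto
      have "v \<in> k n \<rightarrow>\<^sub>E D"
        using v by (auto simp: v_def)
      moreover have "f \<in> W n v"
        unfolding W_def using v d(2) n by auto
      ultimately show ?thesis unfolding C_def by blast
    qed
    moreover have "dist f g < e" if "f \<in> W n v" "g \<in> W n v" for n v f g
    proof -
      have "dist (pm_apply f x) (pm_apply g x) \<le> 4 * \<eta>" for x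
      proof -
        obtain y where y: "y \<in> k n" "dist y x < 1 / real (Suc n)" using k(2) by blast
        then have "dist (pm_apply f y) (pm_apply f x) < \<eta>" "dist (pm_apply g y) (pm_apply g x) < \<eta>"
            "dist (v y) (pm_apply f y) < \<eta>" "dist (v y) (pm_apply g y) < \<eta>"
          using that unfolding W_def by blast+
        then show ?thesis
          using dist_triangle [of "pm_apply f x" "pm_apply g x" "pm_apply f y"]
            dist_triangle [of "pm_apply f y" "pm_apply g x" "v y"]
            dist_triangle [of "v y" "pm_apply g x" "pm_apply g y"]
          by (simp add: dist_commute)
      qed
      then have "dist f g \<le> 4 * \<eta>" by (rule dist_poly_map_le)
      with \<open>e > 0\<close> show ?thesis by (simp add: \<eta>_def)
    qed
    ultimately show ?thesis
      by (intro exI [of _ C]) (auto simp: C_def)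
  qed
  then show "\<exists>B :: poly_map set set. countable B \<and> open = generate_topology B"
    by (rule countable_subbasis_if_countable_covers)
qed

text \<open>Replacing the map \<open>h\<close> by \<open>g\<close> costs at most
  \<open>dist h g\<close> at every point; continuity of \<open>g\<close> at \<open>z\<close> does
  the rest.\<close>

lemma continuous_on_pm_apply_prod: "continuous_on UNIV (\<lambda>(g, z). pm_apply g z)"
proof -
  have "\<exists>d>0. \<forall>y. dist y x < d \<longrightarrow> dist (case y of (g, z) \<Rightarrow> pm_apply g z) (case x of (g, z) \<Rightarrow> pm_apply g z) < e"
    if "e > 0" for x and e :: real
  proof -
    obtain g z where x: "x = (g, z)" by (cases x)
    have "e / 2 > 0" using that by simp
    then obtain d where d: "d > 0" "\<And>w. dist w z < d \<Longrightarrow> dist (pm_apply g w) (pm_apply g z) < e / 2"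
      using continuous_on_pm_apply [of g] unfolding continuous_on_iff by (metis UNIV_I)
    show ?thesis
    proof (intro exI [of _ "min d (e / 2)"] conjI allI impI)
      fix y assume y: "dist y x < min d (e / 2)"
      obtain h w where hw: "y = (h, w)" by (cases y)
      have "dist h g < e / 2" "dist w z < d"
        using y dist_fst_le [of y x] dist_snd_le [of y x] by (auto simp: x hw)
      then show "dist (case y of (g, z) \<Rightarrow> pm_apply g z) (case x of (g, z) \<Rightarrow> pm_apply g z) < e"
        using d(2) [of w] dist_pm_apply_le [of h w g]
          dist_triangle [of "pm_apply h w" "pm_apply g z" "pm_apply g w"] by (simp add: x hw)
    qed (use d that in auto)
  qed
  then show ?thesis unfolding continuous_on_iff by blast
qed

section \<open>Uniform escape near infinity\<close>

text \<open>The difference of the squares of the two sides is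
  \<open>(t - 1) * (t * (cmod z)\<^sup>2 - (cmod r)\<^sup>2)\<close>.\<close>

lemma norm_scaled_diff_root:
  fixes z r :: complex
  assumes "cmod r \<le> cmod z" "1 \<le> t"
  shows "sqrt t * cmod (z - r) \<le> cmod (of_real t * z - r)"
proof (rule power2_le_imp_le)
  have "(cmod r)\<^sup>2 \<le> t * (cmod z)\<^sup>2"
    using power_mono [OF assms(1) norm_ge_zero, of 2] mult_right_mono [OF assms(2) zero_le_power2, of "cmod z"]
    by linarith
  then have "0 \<le> (t - 1) * (t * (cmod z)\<^sup>2 - (cmod r)\<^sup>2)"
    using assms by simp
  also have "\<dots> = (cmod (of_real t * z - r))\<^sup>2 - t * (cmod (z - r))\<^sup>2"
    by (simp add: cmod_power2) (simp add: algebra_simps power2_eq_square)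
  finally show "(sqrt t * cmod (z - r))\<^sup>2 \<le> (cmod (of_real t * z - r))\<^sup>2"
    using assms by (simp add: power_mult_distrib)
qed simp

text \<open>Split off the roots one at a time: by \<open>norm_scaled_diff_root\<close> each linear
  factor grows by at least \<open>sqrt t\<close>. The bound involves no coefficients and is
  therefore uniform over maps of varying degree.\<close>

lemma poly_growth_outside_roots:
  fixes p :: "complex poly"
  assumes "\<And>r. poly p r = 0 \<Longrightarrow> cmod r \<le> cmod z" "1 \<le> t"
  shows "sqrt t ^ degree p * cmod (poly p z) \<le> cmod (poly p (of_real t * z))"
  using assms(1)
proof (induction "degree p" arbitrary: p)
  case 0
  then obtain c where "p = [:c:]" by (metis degree_eq_zeroE)
  then show ?case by simp
next
  case (Suc n)
  have "\<not> constant (poly p)"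
    using Suc.hyps(2) by (metis constant_degree nat.distinct(1))
  then obtain r where r: "poly p r = 0"
    using fundamental_theorem_of_algebra by blast
  then obtain q where p: "p = [:- r, 1:] * q"
    by (metis dvdE poly_eq_0_iff_dvd)
  have pq: "poly p x = (x - r) * poly q x" for x
    by (simp add: p algebra_simps)
  have "q \<noteq> 0" using p Suc.hyps(2) by auto
  then have deg: "degree p = Suc (degree q)"
    unfolding p by (subst degree_mult_eq) auto
  have "sqrt t ^ degree q * cmod (poly q z) \<le> cmod (poly q (of_real t * z))"
    using Suc.prems Suc.hyps(2) deg by (intro Suc.hyps(1)) (auto simp: p)
  moreover have "sqrt t * cmod (z - r) \<le> cmod (of_real t * z - r)"
    using Suc.prems r assms(2) by (intro norm_scaled_diff_root) auto
  ultimately have "(sqrt t * cmod (z - r)) * (sqrt t ^ degree q * cmod (poly q z))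
      \<le> cmod (of_real t * z - r) * cmod (poly q (of_real t * z))"
    using assms(2) by (intro mult_mono) auto
  then show ?case
    by (simp add: deg pq norm_mult mult_ac)
qed

text \<open>\<open>unfin\<close> only strips the constructor here, since a polynomial map sends
  finite points to finite points.\<close>

definition doubling_outside :: "real \<Rightarrow> poly_map \<Rightarrow> bool" where
  "doubling_outside R g \<longleftrightarrow> (\<forall>z. R \<le> cmod z \<longrightarrow> 2 * cmod z \<le> cmod (unfin (pm_apply g (Fin z))))"

lemma pm_apply_Fin: "pm_apply g (Fin z) = Fin (unfin (pm_apply g (Fin z)))"
  by (rule pm_apply_cases [of g]) simp

text \<open>Write p(z) = a + z q(z) with \<open>q\<close> nonconstant. Far out |q| is at least 5,
  and |a| is at most |z|, which leaves a factor 4. The surplus over 2 is spent when passing to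
  nearby maps.\<close>

lemma eventually_doubling:
  obtains R where "R > 0" "\<And>z. R \<le> cmod z \<Longrightarrow> 4 * cmod z \<le> cmod (unfin (pm_apply f (Fin z)))"
proof -
  obtain p where p: "degree p \<ge> 2" "pm_apply f = sphere_poly p" by (rule pm_apply_cases)
  obtain a q where q: "p = pCons a q" by (cases p)
  then have "degree q \<noteq> 0" using p(1) by (auto split: if_splits)
  then have "filterlim (poly q) at_infinity at_infinity"
    by (intro filterlim_poly_at_infinity) simp
  then have "\<forall>\<^sub>F z in at_infinity. 5 \<le> cmod (poly q z)"
    by (simp add: filterlim_at_infinity [of 0])
  then obtain b where b: "\<And>z. b \<le> cmod z \<Longrightarrow> 5 \<le> cmod (poly q z)"
    unfolding eventually_at_infinity by blast
  show thesis
  proof (rule that [of "max 1 (max b (cmod a))"])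
    fix z assume z: "max 1 (max b (cmod a)) \<le> cmod z"
    then have "5 * cmod z \<le> cmod (z * poly q z)"
      using b [of z] mult_left_mono [of 5 "cmod (poly q z)" "cmod z"] by (simp add: norm_mult)
    moreover have "cmod (z * poly q z) \<le> cmod (poly p z) + cmod a"
      using norm_triangle_ineq4 [of "poly p z" a] by (simp add: q)
    ultimately show "4 * cmod z \<le> cmod (unfin (pm_apply f (Fin z)))"
      using z by (simp add: p(2))
  qed simp
qed

text \<open>A map close to \<open>f\<close> has no zeros outside a large disc on whose boundary \<open>f\<close> is large;
  there the growth of a polynomial along rays is controlled by its roots alone.\<close>

lemma locally_doubling:
  obtains R e where "R > 0" "e > 0" "\<And>g. dist f g < e \<Longrightarrow> doubling_outside R g"
proof -
  obtain R where R: "R > 0" "\<And>z. R \<le> cmod z \<Longrightarrow> 4 * cmod z \<le> cmod (unfin (pm_apply f (Fin z)))"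
    by (rule eventually_doubling [of f]) blast
  \<comment> \<open>\<open>\<rho> r\<close> is the distance from the circle of radius
    \<open>r\<close> to infinity. If \<open>f\<close> has modulus at least \<open>4 * R\<close> at a
    point, a map closer to \<open>f\<close> than the gap
    \<open>\<rho> (2 * R) - \<rho> (4 * R)\<close> still has modulus above \<open>2 * R\<close>
    there.\<close>
  define \<rho> where "\<rho> r = dist (Fin (complex_of_real r)) Infinity" for r
  show thesis
  proof (rule that)
    show "R > 0" "0 < \<rho> (2 * R) - \<rho> (4 * R)"
      using R(1) by (simp_all add: \<rho>_def dist_Fin_Infinity_less_iff)
    fix g assume g: "dist f g < \<rho> (2 * R) - \<rho> (4 * R)"
    obtain p where p: "degree p \<ge> 2" "pm_apply g = sphere_poly p" by (rule pm_apply_cases)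
    have large: "2 * R < cmod (poly p z)" if "R \<le> cmod z" for z
    proof -
      have "dist (pm_apply f (Fin z)) Infinity \<le> \<rho> (4 * R)"
        using R that unfolding \<rho>_def by (subst pm_apply_Fin, subst dist_Fin_Infinity_le_iff) force
      then have "dist (pm_apply g (Fin z)) Infinity < \<rho> (2 * R)"
        using g dist_pm_apply_le [of g "Fin z" f] 
          dist_triangle [of "pm_apply g (Fin z)" Infinity "pm_apply f (Fin z)"]
        by (simp add: dist_commute)
      then show ?thesis
        using R(1) by (simp add: p(2) \<rho>_def dist_Fin_Infinity_less_iff)
    qed
    show "doubling_outside R g"
      unfolding doubling_outside_def
    proof (intro allI impI)
      fix z assume z: "R \<le> cmod z"
      \<comment> \<open>\<open>w\<close> is the point of the circle of radius \<open>R\<close> on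
        the ray through \<open>z\<close>, and \<open>t\<close> is the stretching factor from
        \<open>w\<close> to \<open>z\<close>.\<close>
      define t where "t = cmod z / R"
      define w where "w = z / of_real t"
      have t: "1 \<le> t" "of_real t * w = z" "cmod w = R"
        using z R(1) less_le_trans [OF R(1) z] by (auto simp: t_def w_def norm_divide norm_mult)
      \<comment> \<open>By \<open>large\<close> every root lies inside the disc of radius
        \<open>R\<close>.\<close>
      have "cmod r \<le> cmod w" if "poly p r = 0" for r
        using large [of r] that R(1) t by force
      then have *: "sqrt t ^ degree p * cmod (poly p w) \<le> cmod (poly p z)"
        using poly_growth_outside_roots [of p w t] t by simp
      have "t = sqrt t ^ 2" using t by simp
      \<comment> \<open>Here degree at least 2 enters: the growth along the ray is at least linear
        in \<open>t\<close>, so the bound \<open>2 * R\<close> on the circle becomes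
        \<open>2 * cmod z\<close>.\<close>
      also have "\<dots> \<le> sqrt t ^ degree p"
        using t p(1) by (intro power_increasing) auto
      finally have "t * (2 * R) \<le> sqrt t ^ degree p * cmod (poly p w)"
        using large [of w] t R(1) by (intro mult_mono) auto
      then show "2 * cmod z \<le> cmod (unfin (pm_apply g (Fin z)))"
        using * R(1) by (simp add: p(2) t_def)
    qed
  qed
qed

text \<open>Doubling outside a disc persists for larger discs, so the sum of the radii of a finite
  subcover serves all maps. Adding 1 keeps the radius positive even for an empty subcover.\<close>

lemma compact_doubling:
  assumes "compact S"
  obtains R where "R > 0" "\<And>g. g \<in> S \<Longrightarrow> doubling_outside R g"
proof -
  have "\<exists>R e. R > 0 \<and> e > 0 \<and> (\<forall>g. dist f g < e \<longrightarrow> doubling_outside R g)" for f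
    by (rule locally_doubling [of f]) blast
  then obtain r e where re: "\<And>f. r f > 0" "\<And>f. e f > 0" "\<And>f g. dist f g < e f \<Longrightarrow> doubling_outside (r f) g"
    by metis
  have "S \<subseteq> (\<Union>f\<in>S. ball f (e f))"
    using re(2) by auto
  then obtain T where T: "finite T" "S \<subseteq> (\<Union>f\<in>T. ball f (e f))"
    by (rule compactE_image [OF assms, rotated]) auto
  show thesis
  proof (rule that)
    show "0 < 1 + sum r T" using re(1) by (simp add: add_pos_nonneg sum_nonneg less_imp_le)
    fix g assume "g \<in> S"
    then obtain f where f: "f \<in> T" "dist f g < e f" using T by auto
    have "r f \<le> 1 + sum r T"
      using member_le_sum [of f T r] f T re(1) by (simp add: less_imp_le add_increasing)
    with re(3) [OF f(2)] show "doubling_outside (1 + sum r T) g"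
      unfolding doubling_outside_def by force
  qed
qed

section \<open>Escaping and bounded orbits\<close>

lemma random_orbit_add:
  "random_orbit \<gamma> x (m + n) = random_orbit (\<lambda>i. \<gamma> (m + i)) (random_orbit \<gamma> x m) n"
  by (induction n) auto

lemma random_orbit_cong:
  "(\<And>i. i < n \<Longrightarrow> \<gamma> i = \<gamma>' i) \<Longrightarrow> random_orbit \<gamma> x n = random_orbit \<gamma>' x n"
  by (induction n) auto

lemma random_orbit_Infinity [simp]: "random_orbit \<gamma> Infinity n = Infinity"
  by (induction n) auto

text \<open>Stated at \<open>Suc n\<close> because the generated semigroup consists of nonempty
  words only.\<close>

lemma random_orbit_in_semigroup:
  assumes "\<And>i. \<gamma> i \<in> S"
  shows "(\<lambda>x. random_orbit \<gamma> x (Suc n)) \<in> generated_semigroup (pm_apply ` S)"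
proof (induction n)
  case 0
  have "pm_apply (\<gamma> 0) \<in> generated_semigroup (pm_apply ` S)"
    using assms by (intro generated_semigroup.gen imageI)
  then show ?case by (simp add: eta_contract_eq)
next
  case (Suc n)
  have "pm_apply (\<gamma> (Suc n)) \<in> generated_semigroup (pm_apply ` S)"
    using assms by (intro generated_semigroup.gen imageI)
  from generated_semigroup.comp [OF this Suc] show ?case
    by (simp add: comp_def)
qed

text \<open>Every word is an initial segment of an infinite sequence in \<open>S\<close>, so
  estimates for random orbits carry over to the whole semigroup.\<close>

lemma semigroup_random_orbit:
  assumes "g \<in> generated_semigroup (pm_apply ` S)"
  shows "\<exists>\<gamma> n. (\<forall>i. \<gamma> i \<in> S) \<and> g = (\<lambda>x. random_orbit \<gamma> x n)"
  using assms
proof induction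
  case (gen f)
  then obtain h where "h \<in> S" "f = pm_apply h" by blast
  then show ?case by (intro exI [of _ "\<lambda>_. h"] exI [of _ "Suc 0"]) auto
next
  case (comp f g)
  then obtain \<gamma> m \<gamma>' n where f: "\<And>i. \<gamma> i \<in> S" "f = (\<lambda>x. random_orbit \<gamma> x m)"
    and g: "\<And>i. \<gamma>' i \<in> S" "g = (\<lambda>x. random_orbit \<gamma>' x n)" by blast
  \<comment> \<open>In \<open>f \<circ> g\<close> the word of \<open>g\<close> acts first, so it
    occupies the first \<open>n\<close> places.\<close>
  define \<beta> where "\<beta> i = (if i < n then \<gamma>' i else \<gamma> (i - n))" for i
  have "(f \<circ> g) x = random_orbit \<beta> x (n + m)" for x
  proof -
    have "random_orbit \<beta> x n = random_orbit \<gamma>' x n"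
      by (rule random_orbit_cong) (simp add: \<beta>_def)
    moreover have "(\<lambda>i. \<beta> (n + i)) = \<gamma>"
      by (simp add: \<beta>_def)
    ultimately show ?thesis
      by (simp add: random_orbit_add f g)
  qed
  moreover have "\<beta> i \<in> S" for i
    using f(1) g(1) by (simp add: \<beta>_def)
  ultimately show ?case by blast
qed

lemma semigroup_Infinity:
  "g \<in> generated_semigroup (pm_apply ` S) \<Longrightarrow> g Infinity = Infinity"
  by (induction rule: generated_semigroup.induct) auto

text \<open>Separates the deterministic dynamics from the measure; it is instantiated later with
  \<open>S\<close> the support of \<open>\<tau>\<close>.\<close>

locale escaping =
  fixes S :: "poly_map set" and R :: real
  assumes compact_S: "compact S" and S_nonempty: "S \<noteq> {}"
    and R_pos: "R > 0" and doubling: "\<And>g. g \<in> S \<Longrightarrow> doubling_outside R g"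
begin

abbreviation G :: "(csphere \<Rightarrow> csphere) set" where
  "G \<equiv> generated_semigroup (pm_apply ` S)"

definition V :: "csphere set" where
  "V = ball Infinity (dist (Fin (of_real R)) Infinity)"

lemma Fin_in_V_iff [simp]: "Fin z \<in> V \<longleftrightarrow> R < cmod z"
  using R_pos by (simp add: V_def dist_commute [of Infinity] dist_Fin_Infinity_less_iff)

lemma Infinity_in_V [simp]: "Infinity \<in> V"
  by (simp add: V_def)

lemma open_V: "open V"
  by (simp add: V_def)

lemma G_nonempty: "G \<noteq> {}"
  using S_nonempty by (auto intro: generated_semigroup.gen)

lemma random_orbit_doubling:
  assumes "\<And>i. \<gamma> i \<in> S" "R < cmod z"
  shows "\<exists>w. random_orbit \<gamma> (Fin z) n = Fin w \<and> 2 ^ n * R < cmod w"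
proof (induction n)
  case (Suc n)
  then obtain w where w: "random_orbit \<gamma> (Fin z) n = Fin w" "2 ^ n * R < cmod w" by blast
  moreover have "R \<le> cmod w"
    using w(2) mult_right_mono [OF one_le_power [of "2::real" n], of R] R_pos by linarith
  ultimately show ?case
    using doubling [OF assms(1) [of n]] unfolding doubling_outside_def
    by (intro exI [of _ "unfin (pm_apply (\<gamma> n) (Fin w))"]) (fastforce simp: pm_apply_Fin [symmetric])
qed (use assms in auto)

text \<open>After \<open>n\<close> steps the modulus exceeds \<open>2 ^ n * R\<close>, so
  \<open>N\<close> depends on \<open>e\<close> alone and not on the sequence or the starting point.
  This uniformity yields equicontinuity on \<open>V\<close>.\<close>

lemma random_orbit_V_uniform:
  assumes "e > 0"
  obtains N where "\<And>n \<gamma> x. n \<ge> N \<Longrightarrow> (\<forall>i. \<gamma> i \<in> S) \<Longrightarrow> x \<in> V \<Longrightarrow> dist (random_orbit \<gamma> x n) Infinity < e"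
proof -
  have "\<forall>\<^sub>F z in at_infinity. dist (Fin z) Infinity < e"
    by (rule tendstoD [OF Fin_tendsto_Infinity assms])
  then obtain b where b: "\<And>z. b \<le> cmod z \<Longrightarrow> dist (Fin z) Infinity < e"
    unfolding eventually_at_infinity by blast
  obtain N where N: "b / R < 2 ^ N"
    using real_arch_pow [of 2 "b / R"] by auto
  show thesis
  proof (rule that [of N])
    fix n \<gamma> and x assume *: "n \<ge> N" "\<forall>i::nat. \<gamma> i \<in> S" "x \<in> V"
    show "dist (random_orbit \<gamma> x n) Infinity < e"
    proof (cases x)
      case (Fin z)
      then obtain w where w: "random_orbit \<gamma> x n = Fin w" "2 ^ n * R < cmod w"
        using random_orbit_doubling [of \<gamma> z n] * by auto
      have "b < 2 ^ N * R" using N R_pos by (simp add: field_simps)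
      also have "\<dots> \<le> 2 ^ n * R" using * R_pos by (simp add: power_increasing)
      finally show ?thesis using b w by simp
    qed (use assms in simp)
  qed
qed

lemma random_orbit_tendsto_Infinity:
  assumes "\<And>i. \<gamma> i \<in> S" "random_orbit \<gamma> x m \<in> V"
  shows "random_orbit \<gamma> x \<longlonglongrightarrow> Infinity"
proof (rule tendstoI)
  fix e :: real assume "e > 0"
  then obtain N where N: "\<And>n \<gamma> x. n \<ge> N \<Longrightarrow> (\<forall>i. \<gamma> i \<in> S) \<Longrightarrow> x \<in> V \<Longrightarrow>
      dist (random_orbit \<gamma> x n) Infinity < e" by (rule random_orbit_V_uniform) blast
  have "dist (random_orbit \<gamma> x n) Infinity < e" if "m + N \<le> n" for n
    using N [of "n - m" "\<lambda>i. \<gamma> (m + i)" "random_orbit \<gamma> x m"] assms that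
    by (simp flip: random_orbit_add)
  then show "\<forall>\<^sub>F n in sequentially. dist (random_orbit \<gamma> x n) Infinity < e"
    using eventually_sequentially by blast
qed

section \<open>Equicontinuity and the Fatou component at infinity\<close>

lemma uniformly_equicontinuous_S:
  assumes "e > 0"
  obtains d where "d > 0" "\<And>g x y. g \<in> S \<Longrightarrow> dist x y < d \<Longrightarrow> dist (pm_apply g x) (pm_apply g y) < e"
proof -
  have "uniformly_continuous_on (S \<times> UNIV) (\<lambda>(g, z). pm_apply g z)"
    by (intro compact_uniformly_continuous compact_Times compact_S compact_UNIV_csphere
        continuous_on_subset [OF continuous_on_pm_apply_prod]) auto
  then obtain d where d: "d > 0" "\<And>p q. p \<in> S \<times> UNIV \<Longrightarrow> q \<in> S \<times> UNIV \<Longrightarrow> dist q p < d \<Longrightarrow>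
      dist (case q of (g, z) \<Rightarrow> pm_apply g z) (case p of (g, z) \<Rightarrow> pm_apply g z) < e"
    using assms unfolding uniformly_continuous_on_def by metis
  show thesis
    by (rule that [OF d(1)]) (use d(2) [of "(g, y)" "(g, x)" for g x y] in \<open>auto simp: dist_Pair_Pair\<close>)
qed

lemma uniformly_equicontinuous_random_orbit:
  assumes "e > 0"
  shows "\<exists>d>0. \<forall>n\<le>N. \<forall>\<gamma> x y. (\<forall>i. \<gamma> i \<in> S) \<longrightarrow> dist x y < d \<longrightarrow>
    dist (random_orbit \<gamma> x n) (random_orbit \<gamma> y n) < e"
  using assms
proof (induction N arbitrary: e)
  case (Suc N)
  obtain d where d: "d > 0" "\<And>g x y. g \<in> S \<Longrightarrow> dist x y < d \<Longrightarrow> dist (pm_apply g x) (pm_apply g y) < e"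
    using uniformly_equicontinuous_S [OF Suc.prems] by metis
  \<comment> \<open>Tolerance \<open>d\<close> at time \<open>N\<close> allows one more map to be
    applied; tolerance \<open>e\<close> covers the shorter words.\<close>
  obtain d' where d': "d' > 0" "\<And>n \<gamma> x y. n \<le> N \<Longrightarrow> (\<forall>i. \<gamma> i \<in> S) \<Longrightarrow> dist x y < d' \<Longrightarrow>
      dist (random_orbit \<gamma> x n) (random_orbit \<gamma> y n) < min d e"
    using Suc.IH [of "min d e"] d(1) Suc.prems by auto
  have "dist (random_orbit \<gamma> x n) (random_orbit \<gamma> y n) < e"
    if "n \<le> Suc N" "\<forall>i. \<gamma> i \<in> S" "dist x y < d'" for n \<gamma> x y
  proof (cases "n \<le> N")
    case True
    with d'(2) that show ?thesis by force
  next
    case False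
    with that have "n = Suc N" by simp
    moreover have "dist (random_orbit \<gamma> x N) (random_orbit \<gamma> y N) < d"
      using d'(2) [of N \<gamma> x y] that by simp
    ultimately show ?thesis
      using d(2) that by simp
  qed
  with d'(1) show ?case by blast
qed auto

text \<open>Words longer than \<open>N\<close> send all of \<open>V\<close> within
  \<open>e / 2\<close> of \<open>Infinity\<close>; words of length at most \<open>N\<close> are
  uniformly equicontinuous.\<close>

lemma V_subset_Fatou: "V \<subseteq> Fatou G"
proof -
  have "equicontinuous_on V G"
    unfolding equicontinuous_on_def
  proof (intro ballI allI impI)
    fix x and e :: real assume "x \<in> V" "e > 0"
    then have e2: "e / 2 > 0" by simp
    then obtain N where N: "\<And>n \<gamma> x. n \<ge> N \<Longrightarrow> (\<forall>i. \<gamma> i \<in> S) \<Longrightarrow> x \<in> V \<Longrightarrow>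
        dist (random_orbit \<gamma> x n) Infinity < e / 2" by (rule random_orbit_V_uniform) blast
    obtain d where d: "d > 0" "\<And>n \<gamma> x y. n \<le> N \<Longrightarrow> (\<forall>i. \<gamma> i \<in> S) \<Longrightarrow> dist x y < d \<Longrightarrow>
        dist (random_orbit \<gamma> x n) (random_orbit \<gamma> y n) < e"
      using uniformly_equicontinuous_random_orbit [OF \<open>e > 0\<close>, of N] by blast
    have "dist (g y) (g x) < e" if "g \<in> G" "y \<in> V" "dist y x < d" for g y
    proof -
      obtain \<gamma> n where \<gamma>: "\<forall>i. \<gamma> i \<in> S" "g = (\<lambda>x. random_orbit \<gamma> x n)"
        using semigroup_random_orbit [OF \<open>g \<in> G\<close>] by blast
      show ?thesis
      proof (cases "n \<le> N")
        case True
        with d(2) [OF _ \<gamma>(1)] that show ?thesis by (simp add: \<gamma>(2))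
      next
        case False
        then have "dist (g x) Infinity < e / 2" "dist (g y) Infinity < e / 2"
          using N [of n \<gamma>] \<gamma> \<open>x \<in> V\<close> that by auto
        then show ?thesis
          using dist_triangle2 [of "g y" "g x" Infinity] by simp
      qed
    qed
    with d(1) show "\<exists>\<delta>>0. \<forall>g\<in>G. \<forall>y\<in>V. dist y x < \<delta> \<longrightarrow> dist (g y) (g x) < e"
      by blast
  qed
  with open_V show ?thesis unfolding Fatou_def by blast
qed

text \<open>\<open>V\<close> lies between the connected complement of a closed disc and its closure
  on the sphere, to which \<open>Infinity\<close> belongs.\<close>

lemma connected_V: "connected V"
proof (rule connected_intermediate_closure)
  have "connected (- cball (0 :: complex) R)"
    by (intro connected_complement_bounded_convex) auto
  then show "connected (Fin ` (- cball 0 R))"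
    by (intro connected_continuous_image continuous_on_Fin continuous_on_id)
  show "Fin ` (- cball 0 R) \<subseteq> V" by auto
  have "Infinity \<in> closure (Fin ` (- cball 0 R))"
  proof (rule Lim_in_closed_set [OF closed_closure _ _ Fin_tendsto_Infinity])
    show "\<forall>\<^sub>F z in at_infinity. Fin z \<in> closure (Fin ` (- cball 0 R))"
      unfolding eventually_at_infinity
      by (intro exI [of _ "R + 1"] allI impI subsetD [OF closure_subset] imageI) simp
  qed (rule trivial_limit_at_infinity)
  moreover have "x \<in> closure (Fin ` (- cball 0 R))" if "x \<in> V" "x \<noteq> Infinity" for x
    using that by (cases x) (auto intro!: subsetD [OF closure_subset])
  ultimately show "V \<subseteq> closure (Fin ` (- cball 0 R))" by blast
qed

lemma V_subset_Fatou_inf: "V \<subseteq> Fatou_inf G"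
  unfolding Fatou_inf_def
  by (intro connected_component_maximal connected_V V_subset_Fatou) simp

text \<open>On the Fatou set, whether the orbit along a given sequence escapes is locally constant.\<close>

lemma random_orbit_Fatou_inf:
  assumes \<gamma>: "\<And>i. \<gamma> i \<in> S" and x: "x \<in> Fatou_inf G"
  shows "random_orbit \<gamma> x \<longlonglongrightarrow> Infinity"
proof -
  define P where "P y \<longleftrightarrow> random_orbit \<gamma> y \<longlonglongrightarrow> Infinity" for y
  obtain \<rho> where \<rho>: "\<rho> > 0" "ball Infinity \<rho> \<subseteq> V"
    using open_V Infinity_in_V by (meson openE)
  \<comment> \<open>An escaping orbit of \<open>u\<close> is eventually within
    \<open>\<rho> / 2\<close> of \<open>Infinity\<close>. The orbit of \<open>v\<close> is then
    within \<open>\<rho>\<close>, hence in \<open>V\<close>, from where it escapes.\<close>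
  have transfer: "P v" if "P u" and close: "\<And>g. g \<in> G \<Longrightarrow> dist (g u) (g v) < \<rho> / 2" for u v
  proof -
    have "\<forall>\<^sub>F n in sequentially. dist (random_orbit \<gamma> u n) Infinity < \<rho> / 2"
      using that(1) \<rho>(1) unfolding P_def by (intro tendstoD) auto
    then obtain N where "\<And>n. n \<ge> N \<Longrightarrow> dist (random_orbit \<gamma> u n) Infinity < \<rho> / 2"
      unfolding eventually_sequentially by blast
    \<comment> \<open>A positive time is chosen so that the orbit map belongs to
      \<open>G\<close>.\<close>
    then have "dist (random_orbit \<gamma> u (Suc N)) Infinity < \<rho> / 2"
      by (meson le_SucI order.refl)
    moreover have "dist (random_orbit \<gamma> u (Suc N)) (random_orbit \<gamma> v (Suc N)) < \<rho> / 2"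
      using close [OF random_orbit_in_semigroup [of \<gamma> S N, OF \<gamma>]] .
    ultimately have "dist Infinity (random_orbit \<gamma> v (Suc N)) < \<rho>"
      using dist_triangle3 [of Infinity "random_orbit \<gamma> v (Suc N)" "random_orbit \<gamma> u (Suc N)"]
      by linarith
    with \<rho>(2) have "random_orbit \<gamma> v (Suc N) \<in> V" by (meson mem_ball subsetD)
    then show "P v"
      unfolding P_def by (rule random_orbit_tendsto_Infinity [OF \<gamma>])
  qed
  have "P Infinity \<longleftrightarrow> P x"
  proof (rule connected_local_const [of "Fatou_inf G"])
    show "connected (Fatou_inf G)" by (simp add: Fatou_inf_def)
    show "Infinity \<in> Fatou_inf G" using V_subset_Fatou_inf Infinity_in_V by blast
    show "\<forall>a\<in>Fatou_inf G. \<forall>\<^sub>F b in at a within Fatou_inf G. P a = P b"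
    proof
      fix a assume "a \<in> Fatou_inf G"
      then have "a \<in> Fatou G"
        unfolding Fatou_inf_def using connected_component_subset by blast
      then obtain U where U: "open U" "a \<in> U" "equicontinuous_on U G"
        unfolding Fatou_def by blast
      then obtain \<delta> where \<delta>: "\<delta> > 0" "\<And>g y. g \<in> G \<Longrightarrow> y \<in> U \<Longrightarrow> dist y a < \<delta> \<Longrightarrow> dist (g y) (g a) < \<rho> / 2"
        using \<rho>(1) unfolding equicontinuous_on_def by (metis half_gt_zero)
      have "P a = P b" if "b \<in> U \<inter> ball a \<delta>" for b
        using transfer [of a b] transfer [of b a] \<delta>(2) [of _ b] that by (auto simp: dist_commute)
      moreover have "\<forall>\<^sub>F b in at a within Fatou_inf G. b \<in> U \<inter> ball a \<delta>"
        unfolding eventually_at_topological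
        using U \<delta>(1) by (intro exI [of _ "U \<inter> ball a \<delta>"]) auto
      ultimately show "\<forall>\<^sub>F b in at a within Fatou_inf G. P a = P b"
        by (rule eventually_mono [rotated])
    qed
  qed (fact x)
  moreover have "P Infinity"
    by (simp add: P_def tendsto_dist_iff [of "random_orbit \<gamma> Infinity"])
  ultimately show ?thesis by (simp add: P_def)
qed

section \<open>Points with bounded semigroup orbit\<close>

lemma K_hatE:
  assumes "z \<in> K_hat G"
  obtains e where "e > 0" "\<And>g. g \<in> G \<Longrightarrow> e \<le> dist (g (Fin z)) Infinity"
proof -
  obtain B where B: "bounded B" "(\<lambda>g. g (Fin z)) ` G \<subseteq> Fin ` B"
    using assms unfolding K_hat_def by blast
  then obtain b where b: "\<And>w. w \<in> B \<Longrightarrow> cmod w \<le> b"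
    unfolding bounded_iff by blast
  show thesis
  proof (rule that [of "dist (Fin (of_real b)) Infinity"])
    fix g assume "g \<in> G"
    then obtain w where "g (Fin z) = Fin w" "w \<in> B" using B(2) by blast
    then show "dist (Fin (of_real b)) Infinity \<le> dist (g (Fin z)) Infinity"
      using b [of w] by (simp add: dist_Fin_Infinity_le_iff)
  qed simp
qed

text \<open>With \<open>K_hatE\<close> this characterises boundedness in the plane as a positive
  spherical distance from \<open>Infinity\<close>, the form in which equicontinuity can be
  applied.\<close>

lemma K_hatI:
  assumes "e > 0" "\<And>g. g \<in> G \<Longrightarrow> e \<le> dist (g (Fin z)) Infinity"
  shows "z \<in> K_hat G"
proof -
  have "\<forall>\<^sub>F z in at_infinity. dist (Fin z) Infinity < e"
    by (rule tendstoD [OF Fin_tendsto_Infinity assms(1)])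
  then obtain b where b: "\<And>z. b \<le> cmod z \<Longrightarrow> dist (Fin z) Infinity < e"
    unfolding eventually_at_infinity by blast
  have "g (Fin z) \<in> Fin ` cball 0 b" if "g \<in> G" for g
  proof (cases "g (Fin z)")
    case (Fin w)
    then have "cmod w \<le> b" using b [of w] assms(2) [OF that] by force
    with Fin show ?thesis by simp
  next
    case Infinity
    with assms that show ?thesis by force
  qed
  then show ?thesis
    unfolding K_hat_def using bounded_cball by blast
qed

lemma random_orbit_K_hat:
  assumes \<gamma>: "\<And>i. \<gamma> i \<in> S" and "z \<in> K_hat G"
  shows "\<not> random_orbit \<gamma> (Fin z) \<longlonglongrightarrow> Infinity"
proof
  assume *: "random_orbit \<gamma> (Fin z) \<longlonglongrightarrow> Infinity"
  obtain e where e: "e > 0" "\<And>g. g \<in> G \<Longrightarrow> e \<le> dist (g (Fin z)) Infinity"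
    by (rule K_hatE [OF assms(2)]) blast
  from tendstoD [OF * e(1)] obtain N where "\<And>n. n \<ge> N \<Longrightarrow> dist (random_orbit \<gamma> (Fin z) n) Infinity < e"
    unfolding eventually_sequentially by blast
  then have "dist (random_orbit \<gamma> (Fin z) (Suc N)) Infinity < e"
    by (meson le_SucI order.refl)
  with e(2) [OF random_orbit_in_semigroup [of \<gamma> S N, OF \<gamma>]] show False by simp
qed

text \<open>Composing with \<open>g\<close> stays in the semigroup, so the lower bound
  \<open>e\<close> for \<open>z\<close> also serves its image.\<close>

lemma semigroup_K_hat:
  assumes "z \<in> K_hat G" "g \<in> G"
  obtains w where "g (Fin z) = Fin w" "w \<in> K_hat G"
proof -
  obtain e where e: "e > 0" "\<And>g. g \<in> G \<Longrightarrow> e \<le> dist (g (Fin z)) Infinity"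
    by (rule K_hatE [OF assms(1)]) blast
  show thesis
  proof (cases "g (Fin z)")
    case (Fin w)
    have "e \<le> dist (h (Fin w)) Infinity" if "h \<in> G" for h
      using e(2) [OF generated_semigroup.comp [OF that assms(2)]] Fin by simp
    with e(1) have "w \<in> K_hat G" by (rule K_hatI)
    with Fin show thesis by (rule that)
  next
    case Infinity
    with e assms(2) show thesis by force
  qed
qed

text \<open>Equicontinuity at tolerance \<open>e / 2\<close> keeps the orbits of nearby points at
  distance at least \<open>e / 2\<close> from \<open>Infinity\<close>.\<close>

lemma K_hat_Fatou_interior:
  assumes "z \<in> K_hat G" "Fin z \<in> Fatou G"
  shows "Fin z \<in> interior (Fin ` K_hat G)"
proof -
  obtain e where e: "e > 0" "\<And>g. g \<in> G \<Longrightarrow> e \<le> dist (g (Fin z)) Infinity"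
    by (rule K_hatE [OF assms(1)]) blast
  obtain U where U: "open U" "Fin z \<in> U" "equicontinuous_on U G"
    using assms(2) unfolding Fatou_def by blast
  then obtain \<delta> where \<delta>: "\<delta> > 0" "\<And>g y. g \<in> G \<Longrightarrow> y \<in> U \<Longrightarrow> dist y (Fin z) < \<delta> \<Longrightarrow> dist (g y) (g (Fin z)) < e / 2"
    using e(1) unfolding equicontinuous_on_def by (metis half_gt_zero)
  show ?thesis
  proof (rule interiorI [of "U \<inter> ball (Fin z) \<delta>"])
    show "U \<inter> ball (Fin z) \<delta> \<subseteq> Fin ` K_hat G"
    proof
      fix y assume "y \<in> U \<inter> ball (Fin z) \<delta>"
      then have far: "e / 2 \<le> dist (g y) Infinity" if "g \<in> G" for g
        using \<delta>(2) [OF that, of y] e(2) [OF that] dist_triangle [of "g (Fin z)" Infinity "g y"]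
        by (simp add: dist_commute)
      obtain g where "g \<in> G" using G_nonempty by blast
      \<comment> \<open>\<open>Infinity\<close> is fixed by every element of \<open>G\<close>, so it
        would violate the bound.\<close>
      then have "y \<noteq> Infinity"
        using far [of g] e(1) semigroup_Infinity [of g S] by auto
      then obtain w where w: "y = Fin w" by (cases y) auto
      have "w \<in> K_hat G"
        by (rule K_hatI [of "e / 2"]) (use e(1) far w in auto)
      with w show "y \<in> Fin ` K_hat G" by blast
    qed
  qed (use U \<delta>(1) in auto)
qed

lemma semigroup_reaches_absorbing:
  assumes "Julia_ker G = {}"
  shows "\<exists>g\<in>G. g x \<in> V \<union> interior (Fin ` K_hat G)"
proof (cases "x \<in> Fin ` K_hat G")
  case True
  then obtain z where z: "x = Fin z" "z \<in> K_hat G" by blast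
  obtain g where g: "g \<in> G" "g x \<in> Fatou G"
    using assms unfolding Julia_ker_def Julia_def by blast
  obtain w where "g x = Fin w" "w \<in> K_hat G"
    using semigroup_K_hat [OF z(2) g(1)] z(1) by metis
  with g show ?thesis
    using K_hat_Fatou_interior [of w] by (intro bexI [of _ g]) auto
next
  case False
  have "\<exists>g\<in>G. g x \<in> V"
  proof (cases x)
    case (Fin z)
    with False have "z \<notin> K_hat G" by blast
    \<comment> \<open>Otherwise the disc of radius \<open>R\<close> would contain the whole orbit
      and place \<open>z\<close> in \<open>K_hat\<close>.\<close>
    then obtain g where g: "g \<in> G" "g x \<notin> Fin ` cball 0 R"
      unfolding K_hat_def Fin using bounded_cball by blast
    then have "g x \<in> V" by (cases "g x") auto
    with g show ?thesis by blast
  next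
    case Infinity
    then show ?thesis using G_nonempty semigroup_Infinity Infinity_in_V by (metis ex_in_conv)
  qed
  then show ?thesis by blast
qed

end

section \<open>Random orbits and the averaging operator\<close>

text \<open>The complement of the support is the union of all open null sets, and by Lindelof
  countably many of them suffice.\<close>

lemma AE_msupport:
  fixes \<tau> :: "'a::second_countable_topology measure"
  assumes "sets \<tau> = sets borel"
  shows "AE x in \<tau>. x \<in> msupport \<tau>"
proof -
  let ?F = "{U. open U \<and> emeasure \<tau> U = 0}"
  obtain F where F: "F \<subseteq> ?F" "countable F" "\<Union>F = \<Union>?F"
    using Lindelof [of ?F] by blast
  have "- msupport \<tau> = \<Union>F"
    unfolding F(3) msupport_def by (auto simp: zero_less_iff_neq_zero)
  moreover have "U \<in> null_sets \<tau>" if "U \<in> F" for U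
    using that F(1) assms by (auto simp: null_sets_def)
  ultimately have "- msupport \<tau> \<in> null_sets \<tau>"
    using F(2) null_sets_UN' [of F "\<lambda>U. U" \<tau>] by simp
  then show ?thesis
    by (rule AE_I') auto
qed

locale random_polynomials = prob_space \<tau> for \<tau> :: "poly_map measure" +
  assumes sets_eq [measurable_cong]: "sets \<tau> = sets borel"
    and compact_support: "compact (msupport \<tau>)"
begin

lemma space_eq [simp]: "space \<tau> = UNIV"
  using sets_eq_imp_space_eq [OF sets_eq] by simp

lemma msupport_nonempty: "msupport \<tau> \<noteq> {}"
proof
  assume "msupport \<tau> = {}"
  then have "AE g in \<tau>. False"
    using AE_msupport [OF sets_eq] by simp
  then show False by (simp add: AE_False)
qed

abbreviation P :: "(nat \<Rightarrow> poly_map) measure" where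
  "P \<equiv> \<Pi>\<^sub>M j\<in>UNIV. \<tau>"

sublocale seq: sequence_space \<tau> ..

lemma measurable_pm_apply [measurable (raw)]:
  assumes "f \<in> M \<rightarrow>\<^sub>M \<tau>" "h \<in> borel_measurable M"
  shows "(\<lambda>x. pm_apply (f x) (h x)) \<in> borel_measurable M"
proof -
  have "(\<lambda>(g, z). pm_apply g z) \<in> borel_measurable (borel \<Otimes>\<^sub>M borel)"
    unfolding borel_prod by (rule borel_measurable_continuous_onI [OF continuous_on_pm_apply_prod])
  moreover have "(\<lambda>x. (f x, h x)) \<in> M \<rightarrow>\<^sub>M borel \<Otimes>\<^sub>M borel"
    using assms by (intro measurable_Pair) (simp_all cong: measurable_cong_sets add: sets_eq)
  ultimately show ?thesis
    by (auto dest: measurable_compose)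
qed

lemma measurable_random_orbit [measurable (raw)]:
  assumes [measurable]: "f \<in> M \<rightarrow>\<^sub>M P" "h \<in> borel_measurable M"
  shows "(\<lambda>x. random_orbit (f x) (h x) n) \<in> borel_measurable M"
  by (induction n) simp_all

definition escapes :: "csphere \<Rightarrow> (nat \<Rightarrow> poly_map) \<Rightarrow> bool" where
  "escapes z \<gamma> \<longleftrightarrow> random_orbit \<gamma> z \<longlonglongrightarrow> Infinity"

text \<open>Only countable quantifiers occur on the right, so measurability of the escape event
  follows from that of the orbit maps.\<close>

lemma escapes_iff:
  "escapes z \<gamma> \<longleftrightarrow> (\<forall>k. \<exists>N. \<forall>n\<ge>N. dist (random_orbit \<gamma> z n) Infinity < 1 / real (Suc k))"
proof
  assume *: "escapes z \<gamma>"
  show "\<forall>k. \<exists>N. \<forall>n\<ge>N. dist (random_orbit \<gamma> z n) Infinity < 1 / real (Suc k)"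
  proof
    fix k
    have "\<forall>\<^sub>F n in sequentially. dist (random_orbit \<gamma> z n) Infinity < 1 / real (Suc k)"
      using * unfolding escapes_def by (rule tendstoD) simp
    then show "\<exists>N. \<forall>n\<ge>N. dist (random_orbit \<gamma> z n) Infinity < 1 / real (Suc k)"
      by (simp only: eventually_sequentially)
  qed
next
  assume *: "\<forall>k. \<exists>N. \<forall>n\<ge>N. dist (random_orbit \<gamma> z n) Infinity < 1 / real (Suc k)"
  show "escapes z \<gamma>"
    unfolding escapes_def
  proof (rule tendstoI)
    fix e :: real assume "e > 0"
    then obtain k where k: "1 / real (Suc k) < e" using nat_approx_posE by blast
    obtain N where "\<forall>n\<ge>N. dist (random_orbit \<gamma> z n) Infinity < 1 / real (Suc k)"
      using * by blast
    with k have "\<forall>n\<ge>N. dist (random_orbit \<gamma> z n) Infinity < e" by force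
    then show "\<forall>\<^sub>F n in sequentially. dist (random_orbit \<gamma> z n) Infinity < e"
      unfolding eventually_sequentially by blast
  qed
qed

lemma measurable_escapes [measurable (raw)]:
  assumes [measurable]: "f \<in> M \<rightarrow>\<^sub>M P" "h \<in> borel_measurable M"
  shows "Measurable.pred M (\<lambda>x. escapes (h x) (f x))"
  unfolding escapes_iff by measurable

section \<open>The escape probability as a bounded Borel invariant function\<close>

lemma T_inf_eq: "T_inf \<tau> z = (\<integral>\<gamma>. of_bool (escapes z \<gamma>) \<partial>P)"
proof -
  have "{\<gamma> \<in> space P. escapes z \<gamma>} \<in> sets P" by measurable
  then have "measure P {\<gamma> \<in> space P. escapes z \<gamma>} = (\<integral>\<gamma>. indicator {\<gamma> \<in> space P. escapes z \<gamma>} \<gamma> \<partial>P)"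
    by simp
  also have "\<dots> = (\<integral>\<gamma>. of_bool (escapes z \<gamma>) \<partial>P)"
    by (intro Bochner_Integration.integral_cong) (auto simp: indicator_def)
  finally show ?thesis
    by (simp add: T_inf_def escapes_def)
qed

lemma borel_measurable_T_inf: "T_inf \<tau> \<in> borel_measurable borel"
  unfolding T_inf_eq by measurable

text \<open>Prepending \<open>g\<close> shifts the orbit by one step, which does not affect its
  limit.\<close>

lemma escapes_case_nat: "escapes z (case_nat g \<gamma>) \<longleftrightarrow> escapes (pm_apply g z) \<gamma>"
proof -
  have "random_orbit (case_nat g \<gamma>) z (Suc n) = random_orbit \<gamma> (pm_apply g z) n" for n
    using random_orbit_add [of "case_nat g \<gamma>" z 1 n] by simp
  then show ?thesis
    unfolding escapes_def by (subst filterlim_sequentially_Suc [symmetric]) (simp only:)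
qed

text \<open>Condition on the first map: prepending an independent \<open>g\<close> of law
  \<open>\<tau>\<close> to a sequence of law \<open>P\<close> gives law \<open>P\<close> again, and
  Fubini separates the two integrations.\<close>

lemma T_inf_invariant: "T_inf \<tau> = M_op \<tau> (T_inf \<tau>)"
proof
  fix z
  interpret pair_sigma_finite \<tau> P ..
  have [measurable]: "(\<lambda>(g, \<gamma>). case_nat g \<gamma>) \<in> \<tau> \<Otimes>\<^sub>M P \<rightarrow>\<^sub>M P"
    by measurable
  have "T_inf \<tau> z = (\<integral>\<gamma>. of_bool (escapes z \<gamma>) \<partial>distr (\<tau> \<Otimes>\<^sub>M P) P (\<lambda>(g, \<gamma>). case_nat g \<gamma>))"
    by (simp only: seq.PiM_iter T_inf_eq)
  also have "\<dots> = (\<integral>x. of_bool (escapes z (case x of (g, \<gamma>) \<Rightarrow> case_nat g \<gamma>)) \<partial>(\<tau> \<Otimes>\<^sub>M P))"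
    by (rule integral_distr) measurable
  also have "\<dots> = (\<integral>(g, \<gamma>). of_bool (escapes (pm_apply g z) \<gamma>) \<partial>(\<tau> \<Otimes>\<^sub>M P))"
    by (intro Bochner_Integration.integral_cong) (auto simp: escapes_case_nat)
  also have "\<dots> = (\<integral>g. \<integral>\<gamma>. of_bool (escapes (pm_apply g z) \<gamma>) \<partial>P \<partial>\<tau>)"
  proof (rule integral_fst [symmetric])
    interpret Q: pair_prob_space \<tau> P ..
    show "integrable (\<tau> \<Otimes>\<^sub>M P) (\<lambda>(g, \<gamma>). of_bool (escapes (pm_apply g z) \<gamma>) :: real)"
      by (rule Q.integrable_const_bound [where B = 1]) auto
  qed
  finally show "T_inf \<tau> z = M_op \<tau> (T_inf \<tau>) z"
    by (simp add: M_op_def T_inf_eq)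
qed

lemma AE_sequence_in_msupport: "AE \<gamma> in P. \<forall>i. \<gamma> i \<in> msupport \<tau>"
  unfolding AE_all_countable
  by (intro allI AE_PiM_component AE_msupport sets_eq prob_space_axioms UNIV_I)

lemma escaping_radius:
  obtains R where "escaping (msupport \<tau>) R"
proof -
  obtain R where "R > 0" "\<And>g. g \<in> msupport \<tau> \<Longrightarrow> doubling_outside R g"
    by (rule compact_doubling [OF compact_support]) blast
  then have "escaping (msupport \<tau>) R"
    using compact_support msupport_nonempty by unfold_locales
  then show thesis by (rule that)
qed

text \<open>Almost every sequence stays in the support, where the deterministic results decide
  escape on both sets; the probability is therefore 1 or 0 there.\<close>

lemma is_solution_T_inf: "is_solution \<tau> (T_inf \<tau>)"
proof -
  obtain R where "escaping (msupport \<tau>) R" by (rule escaping_radius)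
  then interpret escaping "msupport \<tau>" R .
  have "T_inf \<tau> z = 1" if "z \<in> Fatou_inf (G_semigroup \<tau>)" for z
  proof -
    have "AE \<gamma> in P. of_bool (escapes z \<gamma>) = (1 :: real)"
      using AE_sequence_in_msupport
      by eventually_elim (use that random_orbit_Fatou_inf in \<open>simp add: escapes_def G_semigroup_def\<close>)
    then have "T_inf \<tau> z = (\<integral>\<gamma>. 1 \<partial>P)"
      unfolding T_inf_eq by (intro integral_cong_AE) measurable
    then show ?thesis by (simp add: seq.P.prob_space)
  qed
  moreover have "T_inf \<tau> (Fin z) = 0" if "z \<in> K_hat (G_semigroup \<tau>)" for z
  proof -
    have "AE \<gamma> in P. of_bool (escapes (Fin z) \<gamma>) = (0 :: real)"
      using AE_sequence_in_msupport
      by eventually_elim (use that random_orbit_K_hat in \<open>simp add: escapes_def G_semigroup_def\<close>)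
    then show ?thesis
      unfolding T_inf_eq by (rule integral_eq_zero_AE)
  qed
  moreover have "bounded (range (T_inf \<tau>))"
    by (rule boundedI [of _ 1]) (auto simp: T_inf_def)
  ultimately show ?thesis
    unfolding is_solution_def using borel_measurable_T_inf T_inf_invariant by blast
qed

text \<open>A maximum principle. As \<open>\<psi>\<close> is merely Borel, the supremum of its
  absolute value need not be attained; \<open>peak\<close> points replace maximum points.\<close>

lemma invariant_eq_0:
  fixes \<psi> :: "csphere \<Rightarrow> real"
  assumes meas [measurable]: "\<psi> \<in> borel_measurable borel" and bdd: "bounded (range \<psi>)"
    and inv: "\<psi> = M_op \<tau> \<psi>"
    and "open O'" and zero: "\<And>z. z \<in> O' \<Longrightarrow> \<psi> z = 0"
    and reach: "\<And>z. \<exists>g\<in>G_semigroup \<tau>. g z \<in> O'"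
  shows "\<psi> z = 0"
proof (rule ccontr)
  assume "\<psi> z \<noteq> 0"
  define c where "c = (SUP z. \<bar>\<psi> z\<bar>)"
  obtain b where "\<And>z. \<bar>\<psi> z\<bar> \<le> b"
    using bdd unfolding bounded_iff by auto
  then have le_c: "\<bar>\<psi> z\<bar> \<le> c" for z
    unfolding c_def by (intro cSUP_upper bdd_aboveI2) auto
  have "c > 0"
    using le_c [of z] \<open>\<psi> z \<noteq> 0\<close> by simp
  define peak where "peak z \<longleftrightarrow> (\<forall>U \<epsilon>. open U \<longrightarrow> z \<in> U \<longrightarrow> \<epsilon> > 0 \<longrightarrow> (\<exists>w\<in>U. c - \<epsilon> < \<bar>\<psi> w\<bar>))" for z
  have "\<exists>z. peak z"
  proof (rule ccontr)
    assume "\<nexists>z. peak z"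
    \<comment> \<open>Without peaks every point has a neighbourhood with a definite deficit; by
      compactness the smallest of finitely many deficits would lower the supremum.\<close>
    then have "\<exists>U \<epsilon>. open U \<and> z \<in> U \<and> \<epsilon> > 0 \<and> (\<forall>w\<in>U. \<bar>\<psi> w\<bar> \<le> c - \<epsilon>)" for z
      unfolding peak_def by (meson not_le)
    then obtain U \<epsilon> where U: "\<And>z. open (U z)" "\<And>z. z \<in> U z" "\<And>z. \<epsilon> z > 0"
        "\<And>z w. w \<in> U z \<Longrightarrow> \<bar>\<psi> w\<bar> \<le> c - \<epsilon> z"
      by metis
    obtain T where T: "finite T" "UNIV \<subseteq> (\<Union>z\<in>T. U z)"
      by (rule compactE_image [OF compact_UNIV_csphere, of UNIV U]) (use U in blast)+
    then have "T \<noteq> {}" by auto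
    have "\<bar>\<psi> w\<bar> \<le> c - Min (\<epsilon> ` T)" for w
    proof -
      obtain z where z: "z \<in> T" "w \<in> U z" using T(2) by blast
      then have "Min (\<epsilon> ` T) \<le> \<epsilon> z" using T(1) by simp
      with U(4) [OF z(2)] show ?thesis by simp
    qed
    then have "c \<le> c - Min (\<epsilon> ` T)"
      unfolding c_def by (intro cSUP_least) auto
    moreover have "Min (\<epsilon> ` T) > 0"
      using T(1) \<open>T \<noteq> {}\<close> U(3) by simp
    ultimately show False by simp
  qed
  then obtain z0 where "peak z0" ..
  have step: "peak (pm_apply g z)" if "peak z" "g \<in> msupport \<tau>" for g z
    unfolding peak_def
  proof (intro allI impI)
    fix U and \<epsilon> :: real assume U: "open U" "pm_apply g z \<in> U" "\<epsilon> > 0"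
    show "\<exists>w\<in>U. c - \<epsilon> < \<bar>\<psi> w\<bar>"
    proof (rule ccontr)
      assume "\<not> (\<exists>w\<in>U. c - \<epsilon> < \<bar>\<psi> w\<bar>)"
      then have small: "\<bar>\<psi> w\<bar> \<le> c - \<epsilon>" if "w \<in> U" for w using that by force
      have "open ((\<lambda>(g, z). pm_apply g z) -` U)"
        using continuous_on_pm_apply_prod U(1) by (simp add: continuous_on_open_vimage)
      moreover have "(g, z) \<in> (\<lambda>(g, z). pm_apply g z) -` U"
        using U(2) by simp
      ultimately obtain W U' where WU': "open W" "open U'" "(g, z) \<in> W \<times> U'"
          "W \<times> U' \<subseteq> (\<lambda>(g, z). pm_apply g z) -` U"
        by (rule open_prod_elim)
      then have W: "open W" "open U'" "g \<in> W" "z \<in> U'"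
          "\<And>h w. h \<in> W \<Longrightarrow> w \<in> U' \<Longrightarrow> pm_apply h w \<in> U"
        by (auto simp: subset_eq)
      then have [measurable]: "W \<in> sets \<tau>"
        by (simp add: sets_eq)
      have "emeasure \<tau> W > 0"
        using that(2) W unfolding msupport_def by blast
      then have "measure \<tau> W > 0"
        by (simp add: emeasure_eq_measure)
      with U(3) have "\<epsilon> * measure \<tau> W > 0" by simp
      \<comment> \<open>The tolerance is the loss that averaging would incur: maps in
        \<open>W\<close>, of positive mass as \<open>g\<close> is in the support, send
        \<open>w\<close> into \<open>U\<close>, where the deficit is at least
        \<open>\<epsilon>\<close>.\<close>
      with \<open>peak z\<close> W obtain w where w: "w \<in> U'" "c - \<epsilon> * measure \<tau> W < \<bar>\<psi> w\<bar>"
        unfolding peak_def by blast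
      have int: "integrable \<tau> (\<lambda>h. \<psi> (pm_apply h w))"
        by (rule integrable_const_bound [where B = c]) (use le_c in auto)
      have "\<psi> w = (\<integral>h. \<psi> (pm_apply h w) \<partial>\<tau>)"
        using inv by (metis M_op_def)
      then have "\<bar>\<psi> w\<bar> \<le> (\<integral>h. \<bar>\<psi> (pm_apply h w)\<bar> \<partial>\<tau>)"
        by simp
      also have "\<dots> \<le> (\<integral>h. c - \<epsilon> * indicator W h \<partial>\<tau>)"
      proof (rule integral_mono)
        show "integrable \<tau> (\<lambda>h. \<bar>\<psi> (pm_apply h w)\<bar>)"
          using int by simp
        show "\<bar>\<psi> (pm_apply h w)\<bar> \<le> c - \<epsilon> * indicator W h" for h
          using W(5) [OF _ w(1), of h] small le_c by (simp add: indicator_def)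
      qed (simp add: emeasure_eq_measure)
      also have "\<dots> = c - \<epsilon> * measure \<tau> W"
        using prob_space by (simp add: emeasure_eq_measure)
      finally show False using w(2) by simp
    qed
  qed
  have "peak (g z)" if "g \<in> generated_semigroup (pm_apply ` msupport \<tau>)" "peak z" for g z
    using that by (induction arbitrary: z) (auto intro: step)
  then obtain w where "peak w" "w \<in> O'"
    using reach [of z0] \<open>peak z0\<close> unfolding G_semigroup_def by blast
  \<comment> \<open>Being a peak with neighbourhood \<open>O'\<close> and tolerance \<open>c\<close>
    would give a point of \<open>O'\<close> at which \<open>\<psi>\<close> is nonzero.\<close>
  then show False
    unfolding peak_def using \<open>open O'\<close> \<open>c > 0\<close> zero by fastforce
qed

lemma is_solution_unique:
  assumes "Julia_ker (G_semigroup \<tau>) = {}" "is_solution \<tau> \<phi>" "is_solution \<tau> \<phi>'"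
  shows "\<phi> = \<phi>'"
proof
  fix z
  obtain R where "escaping (msupport \<tau>) R" by (rule escaping_radius)
  then interpret escaping "msupport \<tau>" R .
  define \<psi> where "\<psi> z = \<phi> z - \<phi>' z" for z
  have \<phi>: "\<phi> \<in> borel_measurable borel" "bounded (range \<phi>)" "\<phi> = M_op \<tau> \<phi>"
    and \<phi>': "\<phi>' \<in> borel_measurable borel" "bounded (range \<phi>')" "\<phi>' = M_op \<tau> \<phi>'"
    using assms(2,3) unfolding is_solution_def by blast+
  have int: "integrable \<tau> (\<lambda>g. f (pm_apply g w))"
    if [measurable]: "f \<in> borel_measurable borel" and "bounded (range f)" for f :: "csphere \<Rightarrow> real" and w
  proof -
    obtain b where "\<And>z. norm (f z) \<le> b"
      using \<open>bounded (range f)\<close> unfolding bounded_iff by auto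
    then show ?thesis
      by (intro integrable_const_bound [where B = b]) auto
  qed
  have "\<psi> w = M_op \<tau> \<psi> w" for w
  proof -
    have "\<psi> w = M_op \<tau> \<phi> w - M_op \<tau> \<phi>' w"
      using \<phi>(3) \<phi>'(3) by (metis \<psi>_def)
    also have "\<dots> = M_op \<tau> \<psi> w"
      unfolding M_op_def \<psi>_def by (rule Bochner_Integration.integral_diff [symmetric]; intro int \<phi> \<phi>')
    finally show ?thesis .
  qed
  then have "\<psi> = M_op \<tau> \<psi>" by blast
  \<comment> \<open>On \<open>V\<close> both solutions equal 1, since \<open>V\<close> lies in the
    component at infinity; on the interior of \<open>K_hat\<close> both equal 0.\<close>
  moreover have "\<psi> w = 0" if "w \<in> V \<union> interior (Fin ` K_hat G)" for w
  proof -
    have "w \<in> Fatou_inf G \<or> w \<in> Fin ` K_hat G"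
      using that V_subset_Fatou_inf interior_subset by blast
    then show ?thesis
      using assms(2,3) unfolding is_solution_def \<psi>_def G_semigroup_def by auto
  qed
  moreover have "\<psi> \<in> borel_measurable borel"
    unfolding \<psi>_def using \<phi>(1) \<phi>'(1) by measurable
  moreover have "bounded (range \<psi>)"
    unfolding \<psi>_def using \<phi>(2) \<phi>'(2) by (intro bounded_minus_comp) auto
  moreover have "\<exists>g\<in>G_semigroup \<tau>. g w \<in> V \<union> interior (Fin ` K_hat G)" for w
    using semigroup_reaches_absorbing assms(1) unfolding G_semigroup_def by blast
  ultimately have "\<psi> z = 0"
    using invariant_eq_0 [of \<psi> "V \<union> interior (Fin ` K_hat G)"] open_V by blast
  then show "\<phi> z = \<phi>' z" by (simp add: \<psi>_def)
qed

end

theorem proposition3p26: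
  fixes \<tau> :: "poly_map measure"
  assumes "\<tau> \<in> M1c"
    and "Julia_ker (G_semigroup \<tau>) = {}"
    and "K_hat (G_semigroup \<tau>) \<noteq> {}"
  shows "(\<exists>!\<phi>. is_solution \<tau> \<phi>) \<and> (\<forall>\<phi>. is_solution \<tau> \<phi> \<longrightarrow> \<phi> = T_inf \<tau>)"
proof -
  interpret prob_space \<tau>
    using assms(1) by (simp add: M1c_def)
  interpret random_polynomials \<tau>
    using assms(1) by unfold_locales (auto simp: M1c_def)
  show ?thesis
    using is_solution_T_inf is_solution_unique [OF assms(2)] by blast
qed

end
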